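(* Let $n$ and $d$ be integers with $2<d<n-1$. If $G$ is a graph on $n$ vertices having maximum $SLEE$ among all graphs on $n$ vertices with diameter $d$, then $G\cong H_{d,1}$.
   Context: All graphs are finite and simple. For a graph $G$ on $n$ vertices with degree matrix $D$ and adjacency matrix $A$, the signless Laplacian is $Q=D+A$ with eigenvalues $q_1,\ldots,q_n$, and $SLEE(G)=\sum_{i=1}^n e^{q_i}$. Write $\hat d=\lceil d/2\rceil$. The graph $H_{d,1}$ on $n$ vertices is obtained from a complete graph $K_{n-1-d}$ and a disjoint path $P_{d+1}=v_0v_1\ldots v_d$ by joining every vertex of $K_{n-1-d}$ to exactly the three path vertices $v_{\hat d-1},v_{\hat d},v_{\hat d+1}$ (and adding no other edges). *)

theory Defs
  imports
    "Graph_Theory.Graph_Theory"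
    "Jordan_Normal_Form.Char_Poly"
    Complex_Main
begin

text \<open>
  Finite simple graphs are the symmetric loop-free finite digraphs without parallel arcs,
  i.e. the instances of \<^locale>\<open>pair_graph\<close>: an edge joining u and v is the pair of arcs
  (u,v) and (v,u), and the degree of a vertex is its out-degree.
\<close>

text \<open>
  The rows and columns of a matrix are indexed by natural numbers, so the vertices are
  listed in some order. Another order gives a permutation-similar matrix, hence the same
  characteristic polynomial.
\<close>

definition vertex_list :: "'a pair_pre_digraph \<Rightarrow> 'a list" where
  "vertex_list G = (SOME vs. distinct vs \<and> set vs = pverts G)"

definition adjacency_matrix :: "'a pair_pre_digraph \<Rightarrow> real mat" where
  "adjacency_matrix G = (let vs = vertex_list G; n = length vs in
     mat n n (\<lambda>(i, j). if (vs ! i, vs ! j) \<in> parcs G then 1 else 0))"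

definition degree_matrix :: "'a pair_pre_digraph \<Rightarrow> real mat" where
  "degree_matrix G = (let vs = vertex_list G in
     mat_diag (length vs) (\<lambda>i. real (out_degree G (vs ! i))))"

definition signless_laplacian :: "'a pair_pre_digraph \<Rightarrow> real mat" where
  "signless_laplacian G = degree_matrix G + adjacency_matrix G"

text \<open>
  The eigenvalues are counted with multiplicity, as roots of the characteristic polynomial.
  The matrix is real symmetric, so the multiset of real roots has all n of them.
\<close>

definition SLEE :: "'a pair_pre_digraph \<Rightarrow> real" where
  "SLEE G = (\<Sum>q \<in># proots (char_poly (signless_laplacian G)). exp q)"

text \<open>
  The distance is the minimal number of arcs of a walk, and \<open>\<infinity>\<close> if there is none; in
  particular a disconnected graph has diameter \<open>\<infinity>\<close>.
\<close>

definition graph_dist :: "'a pair_pre_digraph \<Rightarrow> 'a \<Rightarrow> 'a \<Rightarrow> ereal" where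
  "graph_dist G u v = wf_digraph.\<mu> G (\<lambda>_. 1) u v"

definition diameter :: "'a pair_pre_digraph \<Rightarrow> ereal" where
  "diameter G = (SUP u\<in>pverts G. SUP v\<in>pverts G. graph_dist G u v)"

definition graphs_with_diameter :: "nat \<Rightarrow> nat \<Rightarrow> 'a pair_pre_digraph set" where
  "graphs_with_diameter n d =
     {G. pair_graph G \<and> card (pverts G) = n \<and> diameter G = ereal (real d)}"

text \<open>
  The graph \<open>H_{d,1}\<close> on n vertices: the numbers 0, ..., d are the path vertices
  \<open>v_0, ..., v_d\<close> and the numbers d + 1, ..., n - 1 are the vertices of the complete graph.
\<close>

definition H1_edge :: "nat \<Rightarrow> nat \<Rightarrow> nat \<Rightarrow> bool" where
  "H1_edge d u v \<longleftrightarrow> (let h = nat \<lceil>real d / 2\<rceil> in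
     (u \<le> d \<and> v = u + 1 \<and> v \<le> d) \<or>
     (d < u \<and> d < v \<and> u \<noteq> v) \<or>
     (d < u \<and> v \<in> {h - 1, h, h + 1}))"

definition H1 :: "nat \<Rightarrow> nat \<Rightarrow> nat pair_pre_digraph" where
  "H1 n d = \<lparr> pverts = {..<n},
     parcs = {(u, v). u < n \<and> v < n \<and> (H1_edge d u v \<or> H1_edge d v u)} \<rparr>"

end

theory Submission
  imports Defs "Jordan_Normal_Form.Schur_Decomposition"
begin

text \<open>
  Since \<open>SLEE(G) = \<Sum>\<^sub>k tr(Q\<^sup>k) / k!\<close>, it suffices to compare traces of powers of \<open>Q\<close>. Let
  \<open>v\<^sub>0 \<dots> v\<^sub>d\<close> be a shortest path realizing the diameter. A vertex w off the path at distance j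
  from \<open>v\<^sub>0\<close> is adjacent at most to \<open>v\<^bsub>j-1\<^esub>, v\<^sub>j, v\<^bsub>j+1\<^esub>\<close>, so G is a subgraph of the graph in
  which the vertices off the path form a clique and each such w is joined to the three path
  vertices around a centre i(w). Adding edges increases every trace.

  The choice of the centres is optimized by polarization. Reflect the path about s/2 and move
  every centre on the smaller side of s/2 to its mirror image. In the basis of the sums and
  differences \<open>e\<^sub>x \<plusminus> e\<^bsub>s-x\<^esub>\<close>, the matrix after the move dominates the absolute values of the entries
  of the matrix before the move. This domination passes to powers, and hence to traces. The gain
  is strict if the move merges two different centres, and also if it shifts a common centre nearer
  to the middle of the path. So the only maximizers are the two middle positions, which are mirror
  images of each other.
\<close>

section \<open>Traces of powers and the signless Laplacian of a weighted graph\<close>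

text \<open>Kernels on a vertex set stand for matrices, so that relabelling vertices is mere
  reindexing. \<open>kpow\<close> is the matrix power, and \<open>estrada\<close> is the trace of
  the matrix exponential.\<close>

primrec kpow :: "'a set \<Rightarrow> ('a \<Rightarrow> 'a \<Rightarrow> real) \<Rightarrow> nat \<Rightarrow> 'a \<Rightarrow> 'a \<Rightarrow> real" where
  "kpow V M 0 = (\<lambda>x y. of_bool (x = y))"
| "kpow V M (Suc k) = (\<lambda>x y. \<Sum>z\<in>V. kpow V M k x z * M z y)"

definition ktrace :: "'a set \<Rightarrow> ('a \<Rightarrow> 'a \<Rightarrow> real) \<Rightarrow> nat \<Rightarrow> real" where
  "ktrace V M k = (\<Sum>x\<in>V. kpow V M k x x)"

definition estrada :: "'a set \<Rightarrow> ('a \<Rightarrow> 'a \<Rightarrow> real) \<Rightarrow> real" where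
  "estrada V M = (\<Sum>k. ktrace V M k / fact k)"

text \<open>A crude bound, but geometric in \<open>k\<close>, which makes the trace series
  comparable with an exponential series.\<close>

lemma abs_kpow_le:
  assumes "finite V" "x \<in> V" "y \<in> V"
  shows "\<bar>kpow V M k x y\<bar> \<le> (\<Sum>u\<in>V. \<Sum>v\<in>V. \<bar>M u v\<bar>) ^ k"
  using assms(3)
proof (induction k arbitrary: y)
  case 0
  then show ?case by simp
next
  case (Suc k)
  let ?B = "\<Sum>u\<in>V. \<Sum>v\<in>V. \<bar>M u v\<bar>"
  have "\<bar>kpow V M (Suc k) x y\<bar> \<le> (\<Sum>z\<in>V. \<bar>kpow V M k x z * M z y\<bar>)"
    by (simp add: sum_abs)
  also have "\<dots> \<le> (\<Sum>z\<in>V. ?B ^ k * \<bar>M z y\<bar>)"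
    using Suc.IH by (intro sum_mono) (auto simp: abs_mult intro: mult_right_mono)
  also have "\<dots> = ?B ^ k * (\<Sum>z\<in>V. \<bar>M z y\<bar>)"
    by (simp add: sum_distrib_left)
  also have "\<dots> \<le> ?B ^ k * ?B"
    using assms(1) Suc.prems
    by (intro mult_left_mono sum_mono zero_le_power sum_nonneg) (auto intro: member_le_sum)
  finally show ?case by (simp add: mult.commute)
qed

lemma summable_ktrace:
  assumes "finite V"
  shows "summable (\<lambda>k. ktrace V M k / fact k)"
proof (rule summable_comparison_test')
  let ?B = "\<Sum>u\<in>V. \<Sum>v\<in>V. \<bar>M u v\<bar>"
  show "summable (\<lambda>k. real (card V) * (?B ^ k / fact k))"
    using summable_exp_generic[of ?B] by (intro summable_mult) (simp add: field_simps)
  fix k :: nat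
  have "\<bar>ktrace V M k\<bar> \<le> (\<Sum>x\<in>V. \<bar>kpow V M k x x\<bar>)"
    by (simp add: ktrace_def sum_abs)
  also have "\<dots> \<le> real (card V) * ?B ^ k"
    using abs_kpow_le[OF assms] by (intro sum_bounded_above) auto
  finally show "norm (ktrace V M k / fact k) \<le> real (card V) * (?B ^ k / fact k)"
    by (simp add: divide_right_mono)
qed

lemma estrada_mono:
  assumes "finite V" "finite W" "\<And>k. ktrace V M k \<le> ktrace W N k"
  shows "estrada V M \<le> estrada W N"
  unfolding estrada_def
  using assms by (intro suminf_le summable_ktrace) (auto intro: divide_right_mono)

lemma estrada_strict_mono:
  assumes "finite V" "finite W" "\<And>k. ktrace V M k \<le> ktrace W N k"
    and "ktrace V M j < ktrace W N j"
  shows "estrada V M < estrada W N"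
proof -
  let ?f = "\<lambda>k. ktrace W N k / fact k - ktrace V M k / fact k"
  have s: "summable ?f"
    using assms by (intro summable_diff summable_ktrace)
  have "0 < suminf ?f"
    using assms by (intro suminf_pos2[OF s, of j]) (auto intro: divide_right_mono divide_strict_right_mono)
  also have "suminf ?f = estrada W N - estrada V M"
    unfolding estrada_def using assms by (intro suminf_diff[symmetric] summable_ktrace)
  finally show ?thesis by simp
qed

lemma kpow_reindex:
  assumes "bij_betw b V W" "x \<in> V" "y \<in> V"
  shows "kpow V (\<lambda>x y. M (b x) (b y)) k x y = kpow W M k (b x) (b y)"
  using assms(3)
proof (induction k arbitrary: y)
  case 0
  then show ?case using assms(1,2) by (auto simp: bij_betw_def inj_on_def)
next
  case (Suc k)
  then show ?case
    by (simp add: sum.reindex_bij_betw[OF assms(1), symmetric] cong: sum.cong)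
qed

lemma ktrace_reindex:
  assumes "bij_betw b V W"
  shows "ktrace V (\<lambda>x y. M (b x) (b y)) k = ktrace W M k"
  unfolding ktrace_def
  by (simp add: kpow_reindex[OF assms] sum.reindex_bij_betw[OF assms, symmetric] cong: sum.cong)

lemma estrada_reindex:
  assumes "bij_betw b V W"
  shows "estrada V (\<lambda>x y. M (b x) (b y)) = estrada W M"
  unfolding estrada_def ktrace_reindex[OF assms] ..

lemma kpow_1:
  assumes "finite V" "x \<in> V"
  shows "kpow V M (Suc 0) x y = M x y"
  using assms by (simp add: of_bool_def if_distrib if_distribR cong: if_cong)

lemma kpow_cong:
  assumes "\<And>x y. x \<in> V \<Longrightarrow> y \<in> V \<Longrightarrow> M x y = N x y" "x \<in> V" "y \<in> V"
  shows "kpow V M k x y = kpow V N k x y"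
  using assms(3) by (induction k arbitrary: y) (auto intro!: sum.cong simp: assms)

lemma estrada_cong:
  assumes "\<And>x y. x \<in> V \<Longrightarrow> y \<in> V \<Longrightarrow> M x y = N x y"
  shows "estrada V M = estrada V N"
  unfolding estrada_def ktrace_def using kpow_cong[of V M N] assms by simp

lemma kpow_nonneg:
  assumes "\<And>x y. x \<in> V \<Longrightarrow> y \<in> V \<Longrightarrow> 0 \<le> M x y" "x \<in> V" "y \<in> V"
  shows "0 \<le> kpow V M k x y"
  using assms(3) by (induction k arbitrary: y) (auto intro!: sum_nonneg mult_nonneg_nonneg assms)

lemma kpow_mono:
  assumes "\<And>x y. x \<in> V \<Longrightarrow> y \<in> V \<Longrightarrow> 0 \<le> M x y"
    and "\<And>x y. x \<in> V \<Longrightarrow> y \<in> V \<Longrightarrow> M x y \<le> N x y" "x \<in> V" "y \<in> V"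
  shows "kpow V M k x y \<le> kpow V N k x y"
  using assms(4)
proof (induction k arbitrary: y)
  case (Suc k)
  have "0 \<le> kpow V N k x z" if "z \<in> V" for z
    using Suc.IH[OF that] kpow_nonneg[of V M x z k] assms that by fastforce
  then show ?case
    using Suc assms(1,2) by (auto intro!: sum_mono mult_mono)
qed simp

lemma kpow_add:
  assumes "finite V" "x \<in> V" "y \<in> V"
  shows "kpow V M (j + k) x y = (\<Sum>z\<in>V. kpow V M j x z * kpow V M k z y)"
  using assms(3)
proof (induction k arbitrary: y)
  case 0
  then show ?case using assms by (simp add: of_bool_def if_distrib cong: if_cong)
next
  case (Suc k)
  have "kpow V M (j + Suc k) x y = (\<Sum>u\<in>V. (\<Sum>z\<in>V. kpow V M j x z * kpow V M k z u) * M u y)"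
    using Suc by simp
  also have "\<dots> = (\<Sum>z\<in>V. kpow V M j x z * kpow V M (Suc k) z y)"
    by (simp add: sum_distrib_left sum_distrib_right mult.assoc) (rule sum.swap)
  finally show ?case .
qed

lemma kpow_sym:
  assumes "finite V" "\<And>x y. x \<in> V \<Longrightarrow> y \<in> V \<Longrightarrow> M x y = M y x" "x \<in> V" "y \<in> V"
  shows "kpow V M k x y = kpow V M k y x"
  using assms(3,4)
proof (induction k arbitrary: x y)
  case (Suc k)
  have "kpow V M (Suc k) y x = (\<Sum>z\<in>V. kpow V M (Suc 0) y z * kpow V M k z x)"
    using kpow_add[of V y x M "Suc 0" k] assms(1) Suc.prems by simp
  also have "\<dots> = (\<Sum>z\<in>V. kpow V M k x z * M z y)"
    using Suc assms(1,2) by (intro sum.cong) (auto simp: kpow_1 simp del: kpow.simps)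
  finally show ?case by simp
qed auto

text \<open>For a symmetric kernel an even trace is a squared Frobenius norm. This turns a strict
  gain in one entry of a power into a strict gain of a trace.\<close>

lemma ktrace_double:
  assumes "finite V" "\<And>x y. x \<in> V \<Longrightarrow> y \<in> V \<Longrightarrow> M x y = M y x"
  shows "ktrace V M (j + j) = (\<Sum>x\<in>V. \<Sum>y\<in>V. (kpow V M j x y)\<^sup>2)"
  unfolding ktrace_def power2_eq_square
  using assms by (intro sum.cong refl) (simp add: kpow_add kpow_sym[OF assms] cong: sum.cong)

section \<open>The signless Laplacian \<open>D + A\<close> of loop-free weights\<close>

definition lap :: "'a set \<Rightarrow> ('a \<Rightarrow> 'a \<Rightarrow> real) \<Rightarrow> 'a \<Rightarrow> 'a \<Rightarrow> real" where
  "lap V a x y = (if x = y then \<Sum>z\<in>V. a x z else a x y)"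

lemma lap_sym:
  assumes "\<And>x y. a x y = a y x"
  shows "lap V a x y = lap V a y x"
  using assms by (auto simp: lap_def)

lemma lap_reindex:
  assumes "bij_betw b V W" "x \<in> V" "y \<in> V"
  shows "lap W a (b x) (b y) = lap V (\<lambda>x y. a (b x) (b y)) x y"
  unfolding lap_def inj_on_eq_iff[OF bij_betw_imp_inj_on[OF assms(1)] assms(2,3)]
    sum.reindex_bij_betw[OF assms(1), symmetric] ..

lemma estrada_lap_reindex:
  assumes "bij_betw b V W"
  shows "estrada V (lap V (\<lambda>x y. a (b x) (b y))) = estrada W (lap W a)"
  using estrada_cong[of V "\<lambda>x y. lap W a (b x) (b y)", OF lap_reindex[OF assms]]
  by (simp add: estrada_reindex[OF assms])

lemma lap_cong:
  assumes "\<And>x y. x \<in> V \<Longrightarrow> y \<in> V \<Longrightarrow> a x y = a' x y" "x \<in> V" "y \<in> V"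
  shows "lap V a x y = lap V a' x y"
  using assms by (auto simp: lap_def)

lemma lap_nonneg:
  assumes "\<And>x y. 0 \<le> a x y"
  shows "0 \<le> lap V a x y"
  using assms by (auto simp: lap_def intro: sum_nonneg)

lemma lap_mono:
  assumes "\<And>x y. x \<in> V \<Longrightarrow> y \<in> V \<Longrightarrow> a x y \<le> a' x y" "x \<in> V" "y \<in> V"
  shows "lap V a x y \<le> lap V a' x y"
  using assms by (auto simp: lap_def intro: sum_mono)

lemma estrada_lap_mono:
  assumes "finite V" "\<And>x y. 0 \<le> a x y"
    and "\<And>x y. x \<in> V \<Longrightarrow> y \<in> V \<Longrightarrow> a x y \<le> a' x y"
  shows "estrada V (lap V a) \<le> estrada V (lap V a')"
proof (rule estrada_mono[OF assms(1,1)])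
  show "ktrace V (lap V a) k \<le> ktrace V (lap V a') k" for k
    unfolding ktrace_def
    by (intro sum_mono kpow_mono lap_nonneg lap_mono) (use assms in auto)
qed

lemma estrada_lap_strict_mono:
  assumes "finite V" "\<And>x y. 0 \<le> a x y"
    and "\<And>x y. x \<in> V \<Longrightarrow> y \<in> V \<Longrightarrow> a x y \<le> a' x y"
    and "u \<in> V" "v \<in> V" "a u v < a' u v"
  shows "estrada V (lap V a) < estrada V (lap V a')"
proof (rule estrada_strict_mono[OF assms(1,1)])
  show "ktrace V (lap V a) k \<le> ktrace V (lap V a') k" for k
    unfolding ktrace_def
    by (intro sum_mono kpow_mono lap_nonneg lap_mono) (use assms in auto)
  \<comment> \<open>The first trace is the total weight, so it already detects a single larger
    weight.\<close>
  have *: "ktrace V (lap V b) (Suc 0) = (\<Sum>x\<in>V. \<Sum>z\<in>V. b x z)" for b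
    using assms(1) by (simp add: ktrace_def lap_def kpow_1 del: kpow.simps)
  show "ktrace V (lap V a) (Suc 0) < ktrace V (lap V a') (Suc 0)"
    unfolding * using assms
    by (intro sum_strict_mono_ex1 ballI sum_mono bexI[of _ u] bexI[of _ v]) auto
qed

section \<open>Polarization\<close>

text \<open>\<open>R\<close> is a closed half of \<open>V\<close>: it contains a point of each orbit
  of the involution, both points only if they coincide, and hence every fixed point.\<close>

locale reflection =
  fixes V R :: "'a set" and \<sigma> :: "'a \<Rightarrow> 'a"
  assumes finite_V: "finite V"
    and R_subset: "R \<subseteq> V"
    and refl_in: "x \<in> V \<Longrightarrow> \<sigma> x \<in> V"
    and refl_refl: "x \<in> V \<Longrightarrow> \<sigma> (\<sigma> x) = x"
    and cover: "x \<in> V \<Longrightarrow> x \<in> R \<or> \<sigma> x \<in> R"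
    and fixed: "x \<in> R \<Longrightarrow> \<sigma> x \<in> R \<Longrightarrow> \<sigma> x = x"
begin

text \<open>For signs \<open>\<epsilon>\<close>, \<open>\<delta>\<close>, up to scaling, the entry of F between \<open>e\<^sub>x + \<epsilon> e\<^bsub>\<sigma> x\<^esub>\<close> and \<open>e\<^sub>y + \<delta> e\<^bsub>\<sigma> y\<^esub>\<close>; R holds
  one representative of each mirror pair.\<close>

definition par :: "real \<Rightarrow> real \<Rightarrow> ('a \<Rightarrow> 'a \<Rightarrow> real) \<Rightarrow> 'a \<Rightarrow> 'a \<Rightarrow> real" where
  "par \<epsilon> \<delta> F x y = F x y + \<epsilon> * F (\<sigma> x) y + \<delta> * F x (\<sigma> y) + \<epsilon> * \<delta> * F (\<sigma> x) (\<sigma> y)"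

text \<open>The kernels need not commute with \<open>\<sigma>\<close>, so mixed signs give nonzero
  entries too, and products involve all four sign patterns.\<close>

definition dom :: "('a \<Rightarrow> 'a \<Rightarrow> real) \<Rightarrow> ('a \<Rightarrow> 'a \<Rightarrow> real) \<Rightarrow> bool" where
  "dom F F' \<longleftrightarrow> (\<forall>x\<in>R. \<forall>y\<in>R. \<forall>\<epsilon>\<in>{1,-1}. \<forall>\<delta>\<in>{1,-1}. \<bar>par \<epsilon> \<delta> F x y\<bar> \<le> par \<epsilon> \<delta> F' x y)"

definition rep :: "'a \<Rightarrow> 'a" where
  "rep x = (if x \<in> R then x else \<sigma> x)"

lemma rep_in: "x \<in> V \<Longrightarrow> rep x \<in> R"
  using cover by (auto simp: rep_def)

lemma bij_refl: "bij_betw \<sigma> V V"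
  using refl_in refl_refl by (intro bij_betw_byWitness[of _ \<sigma>]) auto

lemma sum_refl: "(\<Sum>z\<in>V. f (\<sigma> z)) = (\<Sum>z\<in>V. f z)"
  by (rule sum.reindex_bij_betw[OF bij_refl])

text \<open>Matrix multiplication in the basis of even and odd vectors. The factor 1/4 is uniform
  over \<open>V\<close>: a proper pair has vectors of squared norm 2 and is counted twice, while a
  fixed point is counted once with even vector twice the unit vector and odd vector 0.\<close>

lemma par_mult:
  assumes "\<epsilon> \<in> {1,-1}" "\<delta> \<in> {1,-1}"
  shows "par \<epsilon> \<delta> (\<lambda>x y. \<Sum>z\<in>V. F x z * G z y) x y =
    (\<Sum>z\<in>V. par \<epsilon> 1 F x (rep z) * par 1 \<delta> G (rep z) y + par \<epsilon> (-1) F x (rep z) * par (-1) \<delta> G (rep z) y) / 4"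
proof -
  define f where "f z = F x z + \<epsilon> * F (\<sigma> x) z" for z
  define g where "g z = G z y + \<delta> * G z (\<sigma> y)" for z
  have "par \<epsilon> \<delta> (\<lambda>x y. \<Sum>z\<in>V. F x z * G z y) x y = (\<Sum>z\<in>V. f z * g z)"
    unfolding par_def f_def g_def
    by (simp add: algebra_simps sum.distrib sum_distrib_left)
  also have "\<dots> = (\<Sum>z\<in>V. f z * g z + f (\<sigma> z) * g (\<sigma> z)) / 2"
    by (simp add: sum.distrib sum_refl[of "\<lambda>z. f z * g z"])
  also have "\<dots> = (\<Sum>z\<in>V. 2 * (f z * g z + f (\<sigma> z) * g (\<sigma> z))) / 4"
    by (subst sum_distrib_left[symmetric]) simp
  also have "(\<Sum>z\<in>V. 2 * (f z * g z + f (\<sigma> z) * g (\<sigma> z))) =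
      (\<Sum>z\<in>V. par \<epsilon> 1 F x (rep z) * par 1 \<delta> G (rep z) y + par \<epsilon> (-1) F x (rep z) * par (-1) \<delta> G (rep z) y)"
  proof (rule sum.cong[OF refl])
    fix z assume "z \<in> V"
    then show "2 * (f z * g z + f (\<sigma> z) * g (\<sigma> z)) =
      par \<epsilon> 1 F x (rep z) * par 1 \<delta> G (rep z) y + par \<epsilon> (-1) F x (rep z) * par (-1) \<delta> G (rep z) y"
      unfolding par_def f_def g_def rep_def
      by (cases "z \<in> R") (simp_all add: refl_refl algebra_simps)
  qed
  finally show ?thesis .
qed

lemma refl_distinct:
  assumes "x \<in> R" "y \<in> R" "x \<noteq> y"
  shows "\<sigma> x \<noteq> y" "x \<noteq> \<sigma> y" "\<sigma> x \<noteq> \<sigma> y"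
proof -
  have "\<sigma> (\<sigma> x) = x" "\<sigma> (\<sigma> y) = y"
    using assms(1,2) R_subset refl_refl by blast+
  then show "\<sigma> x \<noteq> y" "x \<noteq> \<sigma> y" "\<sigma> x \<noteq> \<sigma> y"
    using assms fixed[of x] fixed[of y] by auto
qed

lemma abs_mult_le:
  fixes a b c d :: real
  assumes "\<bar>a\<bar> \<le> c" "\<bar>b\<bar> \<le> d"
  shows "\<bar>a * b\<bar> \<le> c * d"
  using assms by (simp add: abs_mult mult_mono')

text \<open>By \<open>par_mult\<close> an entry of the product is a sum of products of entries with
  positive coefficients, so the triangle inequality carries the domination over.\<close>

lemma dom_mult:
  assumes "dom F F'" "dom G G'"
  shows "dom (\<lambda>x y. \<Sum>z\<in>V. F x z * G z y) (\<lambda>x y. \<Sum>z\<in>V. F' x z * G' z y)"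
  unfolding dom_def
proof (intro ballI)
  fix x y \<epsilon> \<delta> assume xy: "x \<in> R" "y \<in> R" and s: "\<epsilon> \<in> {1,-1::real}" "\<delta> \<in> {1,-1::real}"
  let ?t = "\<lambda>F G z \<eta>. par \<epsilon> \<eta> F x (rep z) * par \<eta> \<delta> G (rep z) y"
  have t: "\<bar>?t F G z \<eta>\<bar> \<le> ?t F' G' z \<eta>" if "z \<in> V" "\<eta> \<in> {1,-1}" for z \<eta>
    using assms xy s that rep_in[OF that(1)] unfolding dom_def by (intro abs_mult_le) blast+
  have "\<bar>\<Sum>z\<in>V. ?t F G z 1 + ?t F G z (-1)\<bar> \<le> (\<Sum>z\<in>V. \<bar>?t F G z 1 + ?t F G z (-1)\<bar>)"
    by (rule sum_abs)
  also have "\<dots> \<le> (\<Sum>z\<in>V. ?t F' G' z 1 + ?t F' G' z (-1))"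
    using t by (intro sum_mono order.trans[OF abs_triangle_ineq] add_mono) auto
  finally show "\<bar>par \<epsilon> \<delta> (\<lambda>x y. \<Sum>z\<in>V. F x z * G z y) x y\<bar>
      \<le> par \<epsilon> \<delta> (\<lambda>x y. \<Sum>z\<in>V. F' x z * G' z y) x y"
    unfolding par_mult[OF s] by (simp add: divide_right_mono)
qed

lemma dom_kpow:
  assumes "dom M M'"
  shows "dom (kpow V M k) (kpow V M' k)"
proof (induction k)
  case 0
  \<comment> \<open>The identity compares with itself, so only nonnegativity matters: the entry is 0
    for distinct representatives, \<open>1 + \<epsilon> * \<delta>\<close> for a proper pair and
    \<open>(1 + \<epsilon>) * (1 + \<delta>)\<close> at a fixed point.\<close>
  have "\<bar>par \<epsilon> \<delta> (\<lambda>x y. of_bool (x = y)) x y\<bar> \<le> par \<epsilon> \<delta> (\<lambda>x y. of_bool (x = y)) x y"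
    if "x \<in> R" "y \<in> R" "\<epsilon> \<in> {1,-1}" "\<delta> \<in> {1,-1}" for x y and \<epsilon> \<delta> :: real
  proof (cases "x = y")
    case True
    then show ?thesis using that by (cases "\<sigma> x = x") (auto simp: par_def)
  next
    case False
    then show ?thesis using refl_distinct[OF that(1,2)] by (auto simp: par_def)
  qed
  then show ?case unfolding dom_def by simp
next
  case (Suc k)
  then show ?case using dom_mult[OF Suc assms] by simp
qed

text \<open>The trace in the even-odd basis, where only equal signs contribute, with the same
  normalization as in \<open>par_mult\<close>.\<close>

lemma trace_par: "(\<Sum>z\<in>V. F z z) = (\<Sum>z\<in>V. par 1 1 F (rep z) (rep z) + par (-1) (-1) F (rep z) (rep z)) / 4"
proof -
  have "(\<Sum>z\<in>V. par 1 1 F (rep z) (rep z) + par (-1) (-1) F (rep z) (rep z)) = (\<Sum>z\<in>V. 2 * F z z + 2 * F (\<sigma> z) (\<sigma> z))"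
    by (intro sum.cong refl) (auto simp: par_def rep_def refl_refl)
  also have "\<dots> = 4 * (\<Sum>z\<in>V. F z z)"
    by (simp add: sum.distrib sum_distrib_left[symmetric] sum_refl[of "\<lambda>z. F z z"])
  finally show ?thesis by simp
qed

lemma ktrace_dom:
  assumes "dom M M'"
  shows "ktrace V M k \<le> ktrace V M' k"
proof -
  have "par \<eta> \<eta> (kpow V M k) (rep z) (rep z) \<le> par \<eta> \<eta> (kpow V M' k) (rep z) (rep z)"
    if "z \<in> V" "\<eta> \<in> {1,-1}" for z \<eta>
    using dom_kpow[OF assms, of k] rep_in[OF that(1)] that(2) unfolding dom_def
    by (meson abs_le_D1)
  then show ?thesis
    unfolding ktrace_def trace_par[of "kpow V M k"] trace_par[of "kpow V M' k"]
    by (auto intro!: divide_right_mono sum_mono add_mono)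
qed

text \<open>Parseval's identity in the even-odd basis; each of the two indices brings a factor
  1/4.\<close>

lemma sum_squares_par:
  "(\<Sum>x\<in>V. \<Sum>y\<in>V. (F x y)\<^sup>2) = (\<Sum>x\<in>V. \<Sum>y\<in>V. \<Sum>\<epsilon>\<in>{1,-1}. \<Sum>\<delta>\<in>{1,-1}. (par \<epsilon> \<delta> F (rep x) (rep y))\<^sup>2) / 16"
proof -
  have "(\<Sum>\<epsilon>\<in>{1,-1}. \<Sum>\<delta>\<in>{1,-1}. (par \<epsilon> \<delta> F (rep x) (rep y))\<^sup>2)
      = 4 * (F x y)\<^sup>2 + 4 * (F (\<sigma> x) y)\<^sup>2 + 4 * (F x (\<sigma> y))\<^sup>2 + 4 * (F (\<sigma> x) (\<sigma> y))\<^sup>2"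
    if "x \<in> V" "y \<in> V" for x y
    using that by (auto simp: par_def rep_def refl_refl power2_eq_square algebra_simps)
  then have "(\<Sum>x\<in>V. \<Sum>y\<in>V. \<Sum>\<epsilon>\<in>{1,-1}. \<Sum>\<delta>\<in>{1,-1}. (par \<epsilon> \<delta> F (rep x) (rep y))\<^sup>2) =
      (\<Sum>x\<in>V. \<Sum>y\<in>V. 4 * (F x y)\<^sup>2 + 4 * (F (\<sigma> x) y)\<^sup>2 + 4 * (F x (\<sigma> y))\<^sup>2 + 4 * (F (\<sigma> x) (\<sigma> y))\<^sup>2)"
    by (intro sum.cong refl) blast
  also have "\<dots> = 16 * (\<Sum>x\<in>V. \<Sum>y\<in>V. (F x y)\<^sup>2)"
  proof -
    have 1: "(\<Sum>y\<in>V. (F x (\<sigma> y))\<^sup>2) = (\<Sum>y\<in>V. (F x y)\<^sup>2)" for x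
      by (rule sum_refl)
    have 2: "(\<Sum>x\<in>V. \<Sum>y\<in>V. (F (\<sigma> x) y)\<^sup>2) = (\<Sum>x\<in>V. \<Sum>y\<in>V. (F x y)\<^sup>2)"
      by (rule sum_refl)
    show ?thesis by (simp add: sum.distrib sum_distrib_left[symmetric] 1 2)
  qed
  finally show ?thesis by simp
qed

text \<open>Domination makes every squared entry grow weakly, and the one singled out strictly. With
  \<open>ktrace_double\<close> this becomes a strict inequality of traces.\<close>

lemma sum_squares_strict:
  assumes "dom F F'" "u \<in> R" "v \<in> R" "\<epsilon>' \<in> {1,-1}" "\<delta>' \<in> {1,-1}" "\<bar>par \<epsilon>' \<delta>' F u v\<bar> < par \<epsilon>' \<delta>' F' u v"
  shows "(\<Sum>x\<in>V. \<Sum>y\<in>V. (F x y)\<^sup>2) < (\<Sum>x\<in>V. \<Sum>y\<in>V. (F' x y)\<^sup>2)"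
proof -
  have le: "(par \<epsilon> \<delta> F (rep x) (rep y))\<^sup>2 \<le> (par \<epsilon> \<delta> F' (rep x) (rep y))\<^sup>2"
    if "x \<in> V" "y \<in> V" "\<epsilon> \<in> {1,-1}" "\<delta> \<in> {1,-1}" for x y \<epsilon> \<delta>
  proof -
    have "\<bar>par \<epsilon> \<delta> F (rep x) (rep y)\<bar> \<le> par \<epsilon> \<delta> F' (rep x) (rep y)"
      using assms(1) that rep_in unfolding dom_def by blast
    then show ?thesis by (metis abs_ge_zero power2_abs power_mono)
  qed
  have lt: "(par \<epsilon>' \<delta>' F (rep u) (rep v))\<^sup>2 < (par \<epsilon>' \<delta>' F' (rep u) (rep v))\<^sup>2"
    using assms(2,3,6) power_strict_mono[of "\<bar>par \<epsilon>' \<delta>' F u v\<bar>" _ 2] by (simp add: rep_def)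
  have uv: "u \<in> V" "v \<in> V" using assms R_subset by auto
  have "(\<Sum>x\<in>V. \<Sum>y\<in>V. \<Sum>\<epsilon>\<in>{1,-1}. \<Sum>\<delta>\<in>{1,-1}. (par \<epsilon> \<delta> F (rep x) (rep y))\<^sup>2)
      < (\<Sum>x\<in>V. \<Sum>y\<in>V. \<Sum>\<epsilon>\<in>{1,-1}. \<Sum>\<delta>\<in>{1,-1}. (par \<epsilon> \<delta> F' (rep x) (rep y))\<^sup>2)"
  proof (rule sum_strict_mono_ex1[OF finite_V])
    show "\<exists>x\<in>V. (\<Sum>y\<in>V. \<Sum>\<epsilon>\<in>{1,-1}. \<Sum>\<delta>\<in>{1,-1}. (par \<epsilon> \<delta> F (rep x) (rep y))\<^sup>2)
        < (\<Sum>y\<in>V. \<Sum>\<epsilon>\<in>{1,-1}. \<Sum>\<delta>\<in>{1,-1}. (par \<epsilon> \<delta> F' (rep x) (rep y))\<^sup>2)"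
    proof (rule bexI[OF _ uv(1)], rule sum_strict_mono_ex1[OF finite_V])
      show "\<exists>y\<in>V. (\<Sum>\<epsilon>\<in>{1,-1}. \<Sum>\<delta>\<in>{1,-1}. (par \<epsilon> \<delta> F (rep u) (rep y))\<^sup>2)
          < (\<Sum>\<epsilon>\<in>{1,-1}. \<Sum>\<delta>\<in>{1,-1}. (par \<epsilon> \<delta> F' (rep u) (rep y))\<^sup>2)"
      proof (rule bexI[OF _ uv(2)], rule sum_strict_mono_ex1)
        show "\<exists>\<epsilon>\<in>{1,-1}. (\<Sum>\<delta>\<in>{1,-1}. (par \<epsilon> \<delta> F (rep u) (rep v))\<^sup>2)
            < (\<Sum>\<delta>\<in>{1,-1}. (par \<epsilon> \<delta> F' (rep u) (rep v))\<^sup>2)"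
        proof (rule bexI[OF _ assms(4)], rule sum_strict_mono_ex1)
          show "\<exists>\<delta>\<in>{1,-1}. (par \<epsilon>' \<delta> F (rep u) (rep v))\<^sup>2 < (par \<epsilon>' \<delta> F' (rep u) (rep v))\<^sup>2"
            using lt assms(5) by blast
        qed (rule ballI le[OF uv assms(4)] finite.intros | assumption)+
      qed (rule ballI sum_mono le[OF uv] finite.intros | assumption)+
    qed (rule ballI sum_mono le[OF uv(1)] | assumption)+
  qed (rule ballI sum_mono le | assumption)+
  then show ?thesis unfolding sum_squares_par[of F] sum_squares_par[of F'] by simp
qed

lemma par_rep_right:
  "z \<in> V \<Longrightarrow> par \<epsilon> 1 F x (rep z) = par \<epsilon> 1 F x z"
  by (auto simp: par_def rep_def refl_refl)

text \<open>The sums below leave out the pair itself, whose edge contributes differently to the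
  four signs.\<close>

definition outer :: "real \<Rightarrow> ('a \<Rightarrow> 'a \<Rightarrow> real) \<Rightarrow> 'a \<Rightarrow> real" where
  "outer \<epsilon> a x = (\<Sum>z\<in>V - {x, \<sigma> x}. a x z + \<epsilon> * a (\<sigma> x) z)"

text \<open>The index set is stable under \<open>\<sigma>\<close>, so averaging each term with its
  mirror image expresses \<open>outer\<close> through entries between distinct representatives,
  where domination is available.\<close>

lemma outer_par:
  assumes "x \<in> V"
  shows "outer \<epsilon> a x = (\<Sum>z\<in>V - {x, \<sigma> x}. par \<epsilon> 1 a x (rep z)) / 2"
proof -
  have b: "bij_betw \<sigma> (V - {x, \<sigma> x}) (V - {x, \<sigma> x})"
    using refl_in refl_refl assms by (intro bij_betw_byWitness[of _ \<sigma>]) (auto, metis+)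
  have "(\<Sum>z\<in>V - {x, \<sigma> x}. par \<epsilon> 1 a x (rep z)) =
      (\<Sum>z\<in>V - {x, \<sigma> x}. (a x z + \<epsilon> * a (\<sigma> x) z) + (a x (\<sigma> z) + \<epsilon> * a (\<sigma> x) (\<sigma> z)))"
    by (intro sum.cong refl) (auto simp: par_rep_right, simp add: par_def)
  also have "\<dots> = 2 * outer \<epsilon> a x"
    unfolding outer_def sum.distrib[of "\<lambda>z. a x z + \<epsilon> * a (\<sigma> x) z"]
    by (subst sum.reindex_bij_betw[OF b, of "\<lambda>z. a x z + \<epsilon> * a (\<sigma> x) z"]) simp
  finally show ?thesis by simp
qed

text \<open>The edge joining \<open>x\<close> to its mirror image adds to the Laplacian a multiple
  of the projection onto the even vector of the pair, so only the even-even entry sees it. The rest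
  is the sum or the difference of the two outer degrees. At a fixed point the odd vector
  vanishes.\<close>

lemma par_lap_diag:
  assumes "x \<in> V" "\<And>x y. a x y = a y x" "\<And>x. a x x = 0"
  shows "\<sigma> x \<noteq> x \<Longrightarrow> par 1 1 (lap V a) x x = outer 1 a x + 4 * a x (\<sigma> x)"
    and "\<sigma> x \<noteq> x \<Longrightarrow> par (-1) (-1) (lap V a) x x = outer 1 a x"
    and "\<sigma> x \<noteq> x \<Longrightarrow> par 1 (-1) (lap V a) x x = outer (-1) a x"
    and "\<sigma> x \<noteq> x \<Longrightarrow> par (-1) 1 (lap V a) x x = outer (-1) a x"
    and "\<sigma> x = x \<Longrightarrow> par 1 1 (lap V a) x x = 2 * outer 1 a x"
    and "\<sigma> x = x \<Longrightarrow> par 1 (-1) (lap V a) x x = 0"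
    and "\<sigma> x = x \<Longrightarrow> par (-1) 1 (lap V a) x x = 0"
    and "\<sigma> x = x \<Longrightarrow> par (-1) (-1) (lap V a) x x = 0"
proof -
  have sum1: "(\<Sum>z\<in>V. a x z + \<epsilon> * a (\<sigma> x) z) = outer \<epsilon> a x + (1 + \<epsilon>) * a x (\<sigma> x)" if "\<sigma> x \<noteq> x" for \<epsilon>
    using that assms refl_in[OF assms(1)] finite_V
    by (simp add: outer_def sum.remove[of V x] sum.remove[of "V - {x}" "\<sigma> x"] Diff_insert2[symmetric] assms(2)[of "\<sigma> x" x] algebra_simps)
  have D: "(\<Sum>z\<in>V. a x z) + \<epsilon> * (\<Sum>z\<in>V. a (\<sigma> x) z) = outer \<epsilon> a x + (1 + \<epsilon>) * a x (\<sigma> x)" if "\<sigma> x \<noteq> x" for \<epsilon>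
    unfolding sum1[OF that, symmetric] by (simp add: sum.distrib sum_distrib_left)
  note defs = par_def lap_def assms(2)[of "\<sigma> x" x]
  show "\<sigma> x \<noteq> x \<Longrightarrow> par 1 1 (lap V a) x x = outer 1 a x + 4 * a x (\<sigma> x)"
    "\<sigma> x \<noteq> x \<Longrightarrow> par (-1) (-1) (lap V a) x x = outer 1 a x"
    "\<sigma> x \<noteq> x \<Longrightarrow> par 1 (-1) (lap V a) x x = outer (-1) a x"
    "\<sigma> x \<noteq> x \<Longrightarrow> par (-1) 1 (lap V a) x x = outer (-1) a x"
    using D[of 1] D[of "-1"] by (simp_all add: defs)
  show "\<sigma> x = x \<Longrightarrow> par 1 1 (lap V a) x x = 2 * outer 1 a x"
    using assms finite_V by (simp add: par_def lap_def outer_def sum.remove[of V x] flip: sum_distrib_left)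
  show "\<sigma> x = x \<Longrightarrow> par 1 (-1) (lap V a) x x = 0"
    "\<sigma> x = x \<Longrightarrow> par (-1) 1 (lap V a) x x = 0"
    "\<sigma> x = x \<Longrightarrow> par (-1) (-1) (lap V a) x x = 0"
    by (simp_all add: par_def)
qed

end

text \<open>Domination is assumed for the weights between distinct representatives only. The
  diagonal entries of the Laplacian are degree sums, and their domination is derived through
  \<open>outer\<close>.\<close>

locale polarization = reflection V R \<sigma> for V R :: "'a set" and \<sigma> +
  fixes a a' :: "'a \<Rightarrow> 'a \<Rightarrow> real"
  assumes sym: "\<And>x y. a x y = a y x" "\<And>x y. a' x y = a' y x"
    and irrefl: "\<And>x. a x x = 0" "\<And>x. a' x x = 0"
    and par_le: "\<And>x y \<epsilon> \<delta>. x \<in> R \<Longrightarrow> y \<in> R \<Longrightarrow> x \<noteq> y \<Longrightarrow> \<epsilon> \<in> {1,-1} \<Longrightarrow> \<delta> \<in> {1,-1} \<Longrightarrow>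
      \<bar>par \<epsilon> \<delta> a x y\<bar> \<le> par \<epsilon> \<delta> a' x y"
    and mirror_edge: "\<And>x. x \<in> R \<Longrightarrow> 0 \<le> a x (\<sigma> x) \<and> a x (\<sigma> x) = a' x (\<sigma> x)"
begin

lemma outer_term_le:
  assumes "x \<in> R" "z \<in> V - {x, \<sigma> x}" "\<epsilon> \<in> {1,-1}"
  shows "\<bar>par \<epsilon> 1 a x (rep z)\<bar> \<le> par \<epsilon> 1 a' x (rep z)"
proof -
  have "rep z \<noteq> x"
    using assms refl_refl by (auto simp: rep_def)
  then show ?thesis using assms rep_in[of z] par_le by auto
qed

lemma outer_le:
  assumes "x \<in> R" "\<epsilon> \<in> {1,-1}"
  shows "\<bar>outer \<epsilon> a x\<bar> \<le> outer \<epsilon> a' x"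
proof -
  have x: "x \<in> V" using assms R_subset by auto
  have "\<bar>\<Sum>z\<in>V - {x, \<sigma> x}. par \<epsilon> 1 a x (rep z)\<bar> \<le> (\<Sum>z\<in>V - {x, \<sigma> x}. par \<epsilon> 1 a' x (rep z))"
    using outer_term_le[OF assms(1) _ assms(2)] by (intro order.trans[OF sum_abs] sum_mono) auto
  then show ?thesis unfolding outer_par[OF x] by simp
qed

text \<open>Strictness of an absolute value needs strictness on both sides: \<open>u\<close>
  provides it for the sum and \<open>v\<close> for the negated sum. Neither entry has to grow in
  absolute value.\<close>

lemma outer_less:
  assumes "x \<in> R" "\<epsilon> \<in> {1,-1}" "u \<in> V - {x, \<sigma> x}" "v \<in> V - {x, \<sigma> x}"
    and "par \<epsilon> 1 a x u < par \<epsilon> 1 a' x u" "- par \<epsilon> 1 a x v < par \<epsilon> 1 a' x v"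
  shows "\<bar>outer \<epsilon> a x\<bar> < outer \<epsilon> a' x"
proof -
  have x: "x \<in> V" using assms R_subset by auto
  have le: "par \<epsilon> 1 a x (rep z) \<le> par \<epsilon> 1 a' x (rep z)" "- par \<epsilon> 1 a x (rep z) \<le> par \<epsilon> 1 a' x (rep z)"
    if "z \<in> V - {x, \<sigma> x}" for z
    using outer_term_le[OF assms(1) that assms(2)] by auto
  have "(\<Sum>z\<in>V - {x, \<sigma> x}. par \<epsilon> 1 a x (rep z)) < (\<Sum>z\<in>V - {x, \<sigma> x}. par \<epsilon> 1 a' x (rep z))"
    using assms finite_V by (intro sum_strict_mono_ex1 ballI le bexI[OF _ assms(3)]) (auto simp: par_rep_right)
  moreover have "(\<Sum>z\<in>V - {x, \<sigma> x}. - par \<epsilon> 1 a x (rep z)) < (\<Sum>z\<in>V - {x, \<sigma> x}. par \<epsilon> 1 a' x (rep z))"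
    using assms finite_V by (intro sum_strict_mono_ex1 ballI le bexI[OF _ assms(4)]) (auto simp: par_rep_right)
  ultimately show ?thesis unfolding outer_par[OF x] by (simp add: sum_negf abs_less_iff)
qed

lemma dom_lap: "dom (lap V a) (lap V a')"
  unfolding dom_def
proof (intro ballI)
  fix x y \<epsilon> \<delta> assume xy: "x \<in> R" "y \<in> R" and s: "\<epsilon> \<in> {1,-1::real}" "\<delta> \<in> {1,-1::real}"
  show "\<bar>par \<epsilon> \<delta> (lap V a) x y\<bar> \<le> par \<epsilon> \<delta> (lap V a') x y"
  proof (cases "x = y")
    case False
    then have "\<sigma> x \<noteq> y" "x \<noteq> \<sigma> y" "\<sigma> x \<noteq> \<sigma> y"
      using refl_distinct[OF xy] by auto
    \<comment> \<open>Distinct representatives have disjoint orbits, so no degree enters these four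
      entries.\<close>
    then have "par \<epsilon> \<delta> (lap V b) x y = par \<epsilon> \<delta> b x y" for b
      using False by (simp add: par_def lap_def)
    then show ?thesis using par_le[OF xy False s] by simp
  next
    case True
    have x: "x \<in> V" using xy R_subset by auto
    note o = outer_le[OF xy(1)]
    note p = par_lap_diag[OF x, of a, OF sym(1) irrefl(1)] par_lap_diag[OF x, of a', OF sym(2) irrefl(2)]
    have m: "0 \<le> a x (\<sigma> x) \<and> a x (\<sigma> x) = a' x (\<sigma> x)" by (rule mirror_edge[OF xy(1)])
    show ?thesis unfolding True[symmetric]
      using s o[of 1] o[of "-1"] m by (cases "\<sigma> x = x") (auto simp: p)
  qed
qed

end

section \<open>Eigenvalues of symmetric matrices\<close>

lemma index_pow_mat:
  assumes "A \<in> carrier_mat n n" "i < n" "j < n"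
  shows "(A ^\<^sub>m k) $$ (i, j) = kpow {..<n} (\<lambda>i j. A $$ (i, j)) k i j"
  using assms(3)
proof (induction k arbitrary: j)
  case 0
  then show ?case using assms by auto
next
  case (Suc k)
  have "(A ^\<^sub>m Suc k) $$ (i, j) = (\<Sum>l = 0..<n. (A ^\<^sub>m k) $$ (i, l) * A $$ (l, j))"
    using assms Suc.prems by (simp add: scalar_prod_def times_mat_def)
  then show ?case using Suc.IH by (simp add: atLeast0LessThan)
qed

text \<open>Cyclicity of the trace, applied to the factors \<open>P\<close> and
  \<open>B * Q\<close>.\<close>

lemma sum_diag_similar:
  fixes A B :: "'a :: comm_ring_1 mat"
  assumes "A \<in> carrier_mat n n" "B \<in> carrier_mat n n" "P \<in> carrier_mat n n" "Q \<in> carrier_mat n n"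
    and "A = P * B * Q" "Q * P = 1\<^sub>m n"
  shows "(\<Sum>i<n. A $$ (i, i)) = (\<Sum>i<n. B $$ (i, i))"
proof -
  have swap: "(\<Sum>i<n. (X * Y) $$ (i, i)) = (\<Sum>i<n. (Y * X) $$ (i, i))"
    if "X \<in> carrier_mat n n" "Y \<in> carrier_mat n n" for X Y :: "'a mat"
  proof -
    have "(\<Sum>i<n. (X * Y) $$ (i, i)) = (\<Sum>i<n. \<Sum>j<n. X $$ (i, j) * Y $$ (j, i))"
      using that by (simp add: times_mat_def scalar_prod_def atLeast0LessThan)
    also have "\<dots> = (\<Sum>j<n. \<Sum>i<n. Y $$ (j, i) * X $$ (i, j))"
      by (subst sum.swap) (simp add: mult.commute)
    also have "\<dots> = (\<Sum>i<n. (Y * X) $$ (i, i))"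
      using that by (simp add: times_mat_def scalar_prod_def atLeast0LessThan)
    finally show ?thesis .
  qed
  have "(\<Sum>i<n. A $$ (i, i)) = (\<Sum>i<n. (P * (B * Q)) $$ (i, i))"
    using assms by (simp add: assoc_mult_mat)
  also have "\<dots> = (\<Sum>i<n. ((B * Q) * P) $$ (i, i))"
    by (rule swap) (use assms in auto)
  also have "(B * Q) * P = B"
    using assms by (simp add: assoc_mult_mat)
  finally show ?thesis .
qed

lemma upper_triangular_mult:
  fixes A B :: "'a :: semiring_1 mat"
  assumes "A \<in> carrier_mat n n" "B \<in> carrier_mat n n" "upper_triangular A" "upper_triangular B"
  shows "upper_triangular (A * B)" "i < n \<Longrightarrow> (A * B) $$ (i, i) = A $$ (i, i) * B $$ (i, i)"
proof -
  have index: "(A * B) $$ (i, j) = (\<Sum>l<n. A $$ (i, l) * B $$ (l, j))" if "i < n" "j < n" for i j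
    using assms that by (simp add: times_mat_def scalar_prod_def atLeast0LessThan)
  have zero: "A $$ (i, l) * B $$ (l, j) = 0" if "i < n" "l < n" "j < i \<or> j = i \<and> l \<noteq> i" for i j l
  proof -
    have "l < i \<or> j < l" using that by auto
    then show ?thesis using assms that unfolding upper_triangular_def by auto
  qed
  show "upper_triangular (A * B)"
    unfolding upper_triangular_def using assms index zero by (auto intro!: sum.neutral)
  show "(A * B) $$ (i, i) = A $$ (i, i) * B $$ (i, i)" if "i < n"
  proof -
    have "(\<Sum>l<n. A $$ (i, l) * B $$ (l, i)) = (\<Sum>l\<in>{i}. A $$ (i, l) * B $$ (l, i))"
      using that zero by (intro sum.mono_neutral_right) auto
    then show ?thesis using index[OF that that] by simp
  qed
qed

lemma upper_triangular_pow:
  fixes B :: "'a :: semiring_1 mat"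
  assumes "B \<in> carrier_mat n n" "upper_triangular B"
  shows "upper_triangular (B ^\<^sub>m k) \<and> (\<forall>i<n. (B ^\<^sub>m k) $$ (i, i) = B $$ (i, i) ^ k)"
proof (induction k)
  case 0
  then show ?case using assms by (auto simp: upper_triangular_def)
next
  case (Suc k)
  then show ?case
    using upper_triangular_mult[OF pow_carrier_mat[OF assms(1), of k] assms(1) _ assms(2)]
    by (auto simp: power_commutes)
qed

text \<open>Since the characteristic polynomial splits, there is a real Schur form. Its powers stay
  triangular, with the powers of the eigenvalues on the diagonal, and similarity preserves the
  trace.\<close>

lemma ktrace_eigenvalues:
  fixes A :: "real mat"
  assumes A: "A \<in> carrier_mat n n" and c: "char_poly A = (\<Prod>e\<leftarrow>es. [:- e, 1:])"
  shows "ktrace {..<n} (\<lambda>i j. A $$ (i, j)) k = (\<Sum>e\<leftarrow>es. e ^ k)"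
proof -
  obtain B P Q where "schur_decomposition A es = (B, P, Q)"
    by (cases "schur_decomposition A es")
  from schur_decomposition[OF A c this]
  have w: "similar_mat_wit A B P Q" and B: "upper_triangular B" "diag_mat B = es" by auto
  note w' = similar_mat_witD2[OF A w]
  note wk = similar_mat_witD2[OF pow_carrier_mat[OF A, of k] similar_mat_wit_pow[OF w, of k]]
  have "ktrace {..<n} (\<lambda>i j. A $$ (i, j)) k = (\<Sum>i<n. (A ^\<^sub>m k) $$ (i, i))"
    unfolding ktrace_def using index_pow_mat[OF A] by simp
  also have "\<dots> = (\<Sum>i<n. (B ^\<^sub>m k) $$ (i, i))"
    using wk by (intro sum_diag_similar[of _ _ _ P Q]) auto
  also have "\<dots> = (\<Sum>i<n. B $$ (i, i) ^ k)"
    using upper_triangular_pow[of B n k] B w' by simp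
  also have "\<dots> = (\<Sum>e\<leftarrow>es. e ^ k)"
    unfolding B(2)[symmetric] diag_mat_def using w'
    by (simp add: sum_list_sum_nth interv_sum_list_conv_sum_set_nat atLeast0LessThan o_def)
  finally show ?thesis .
qed

lemma sum_list_exp_eigenvalues:
  fixes A :: "real mat"
  assumes A: "A \<in> carrier_mat n n" and c: "char_poly A = (\<Prod>e\<leftarrow>es. [:- e, 1:])"
  shows "(\<Sum>e\<leftarrow>es. exp e) = estrada {..<n} (\<lambda>i j. A $$ (i, j))"
proof -
  have "(\<lambda>k. \<Sum>e\<leftarrow>es. e ^ k / fact k) sums (\<Sum>e\<leftarrow>es. exp e)"
  proof (induction es)
    case (Cons e es)
    have "(\<lambda>k. e ^ k / fact k) sums exp e"
      using exp_converges[of e] by (simp add: field_simps)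
    then show ?case using Cons by (auto intro: sums_add)
  qed auto
  moreover have "(\<Sum>e\<leftarrow>es. e ^ k / fact k) = ktrace {..<n} (\<lambda>i j. A $$ (i, j)) k / fact k" for k
    unfolding ktrace_eigenvalues[OF A c] by (induction es) (auto simp: add_divide_distrib)
  ultimately show ?thesis
    unfolding estrada_def by (simp add: sums_iff)
qed

text \<open>The Hermitian form of \<open>A\<close> at an eigenvector, evaluated from either side,
  equals both \<open>l\<close> and its conjugate times the squared norm of the eigenvector.\<close>

lemma symmetric_eigenvalue_real:
  fixes A :: "real mat"
  assumes A: "A \<in> carrier_mat n n" and sym: "\<And>i j. i < n \<Longrightarrow> j < n \<Longrightarrow> A $$ (i, j) = A $$ (j, i)"
    and ev: "eigenvalue (map_mat complex_of_real A) l"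
  shows "l \<in> \<real>"
proof -
  let ?A = "map_mat complex_of_real A"
  from ev obtain v where v: "v \<in> carrier_vec n" "v \<noteq> 0\<^sub>v n" "?A *\<^sub>v v = l \<cdot>\<^sub>v v"
    unfolding eigenvalue_def eigenvector_def using A by auto
  have row: "(\<Sum>j<n. of_real (A $$ (i, j)) * v $ j) = l * v $ i" if "i < n" for i
  proof -
    have "(?A *\<^sub>v v) $ i = (\<Sum>j<n. of_real (A $$ (i, j)) * v $ j)"
      using A v(1) that by (simp add: scalar_prod_def atLeast0LessThan)
    then show ?thesis using v that by simp
  qed
  define S where "S = (\<Sum>i<n. cnj (v $ i) * v $ i)"
  have S: "S = of_real (\<Sum>i<n. (cmod (v $ i))\<^sup>2)"
    unfolding S_def by (simp add: complex_norm_square[symmetric] mult.commute)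
  have "l * S = (\<Sum>i<n. cnj (v $ i) * (\<Sum>j<n. of_real (A $$ (i, j)) * v $ j))"
    unfolding S_def sum_distrib_left[of l] by (intro sum.cong) (simp_all add: row mult.left_commute)
  also have "\<dots> = (\<Sum>i<n. \<Sum>j<n. cnj (v $ i) * of_real (A $$ (i, j)) * v $ j)"
    by (simp add: sum_distrib_left algebra_simps)
  also have "\<dots> = (\<Sum>j<n. \<Sum>i<n. v $ j * cnj (of_real (A $$ (j, i)) * v $ i))"
    by (subst sum.swap) (auto intro!: sum.cong simp: sym)
  also have "\<dots> = (\<Sum>j<n. v $ j * cnj (\<Sum>i<n. of_real (A $$ (j, i)) * v $ i))"
    by (simp add: sum_distrib_left)
  also have "\<dots> = cnj l * S"
    unfolding S_def sum_distrib_left[of "cnj l"] by (intro sum.cong) (simp_all add: row)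
  finally have "(l - cnj l) * S = 0" by (simp add: algebra_simps)
  moreover have "S \<noteq> 0"
  proof -
    obtain i where i: "i < n" "v $ i \<noteq> 0" using v by (metis carrier_vecD eq_vecI index_zero_vec)
    have "0 < (\<Sum>i<n. (cmod (v $ i))\<^sup>2)"
      using i by (intro sum_pos2[of _ i]) auto
    then show ?thesis unfolding S of_real_eq_0_iff by simp
  qed
  ultimately have "cnj l = l" by simp
  then show ?thesis by (simp add: Reals_cnj_iff)
qed

text \<open>The polynomial splits over the complex numbers, its roots are real, and the
  factorization descends because the embedding of the reals is injective on coefficients.\<close>

lemma char_poly_symmetric_factorized:
  fixes A :: "real mat"
  assumes A: "A \<in> carrier_mat n n" and sym: "\<And>i j. i < n \<Longrightarrow> j < n \<Longrightarrow> A $$ (i, j) = A $$ (j, i)"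
  obtains es where "char_poly A = (\<Prod>e\<leftarrow>es. [:- e, 1:])"
proof -
  interpret of_real: map_poly_inj_idom_hom complex_of_real ..
  let ?A = "map_mat complex_of_real A"
  have cA: "?A \<in> carrier_mat n n" using A by simp
  obtain as where as: "char_poly ?A = (\<Prod>a\<leftarrow>as. [:- a, 1:])"
    using char_poly_factorized[OF cA] by auto
  have "set as \<subseteq> \<real>"
  proof
    fix a assume "a \<in> set as"
    then have "poly (char_poly ?A) a = 0"
      unfolding as by (induction as) auto
    then have "eigenvalue ?A a" using eigenvalue_root_char_poly[OF cA] by blast
    then show "a \<in> \<real>" by (intro symmetric_eigenvalue_real[OF A] sym)
  qed
  then obtain es where es: "as = map of_real es"
    by (metis ex_map_conv subsetD Reals_cases)
  have "map_poly complex_of_real (char_poly A) = map_poly of_real (\<Prod>e\<leftarrow>es. [:- e, 1:])"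
  proof -
    have "map_poly complex_of_real (\<Prod>e\<leftarrow>es. [:- e, 1:]) = (\<Prod>a\<leftarrow>as. [:- a, 1:])"
      unfolding es by (induction es) (simp_all add: of_real.hom_mult del: mult_pCons_left)
    moreover have "char_poly ?A = map_poly complex_of_real (char_poly A)"
      by (rule of_real_hom.char_poly_hom[OF A])
    ultimately show ?thesis using as by simp
  qed
  then have "char_poly A = (\<Prod>e\<leftarrow>es. [:- e, 1:])"
    by (simp add: poly_eq_iff coeff_map_poly)
  then show ?thesis by (rule that)
qed

lemma proots_linear_factors: "proots (\<Prod>e\<leftarrow>es. [:- e, 1:]) = mset (es :: 'a :: idom list)"
proof (induction es)
  case (Cons e es)
  have "(\<Prod>e\<leftarrow>es. [:- e, 1:]) \<noteq> (0 :: 'a poly)" by (auto simp: prod_list_zero_iff)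
  then show ?case using Cons by (simp add: proots_mult del: mult_pCons_left)
qed simp

lemma sum_exp_proots_symmetric:
  fixes A :: "real mat"
  assumes "A \<in> carrier_mat n n" "\<And>i j. i < n \<Longrightarrow> j < n \<Longrightarrow> A $$ (i, j) = A $$ (j, i)"
  shows "(\<Sum>q\<in>#proots (char_poly A). exp q) = estrada {..<n} (\<lambda>i j. A $$ (i, j))"
proof -
  obtain es where es: "char_poly A = (\<Prod>e\<leftarrow>es. [:- e, 1:])"
    using char_poly_symmetric_factorized[OF assms] .
  show ?thesis
    using sum_list_exp_eigenvalues[OF assms(1) es]
    by (simp add: es proots_linear_factors flip: mset_map sum_mset_sum_list)
qed

section \<open>SLEE as a trace series\<close>

abbreviation arc_kernel :: "'a pair_pre_digraph \<Rightarrow> 'a \<Rightarrow> 'a \<Rightarrow> real" where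
  "arc_kernel G \<equiv> \<lambda>x y. of_bool ((x, y) \<in> parcs G)"

text \<open>The arbitrary vertex order chosen for the matrix disappears here, being a bijective
  reindexing of the kernel.\<close>

lemma SLEE_eq_estrada:
  assumes "pair_graph G"
  shows "SLEE G = estrada (pverts G) (lap (pverts G) (arc_kernel G))"
proof -
  interpret pair_graph G by fact
  define vs where "vs = vertex_list G"
  define n where "n = length vs"
  have "\<exists>vs. distinct vs \<and> set vs = pverts G"
    using finite_distinct_list[OF pair_finite_verts] by blast
  then have vs: "distinct vs" "set vs = pverts G"
    unfolding vs_def vertex_list_def by (metis (mono_tags, lifting) someI_ex)+
  have bij: "bij_betw ((!) vs) {..<n} (pverts G)"
    using vs by (simp add: n_def bij_betw_nth)
  have deg: "real (out_degree G v) = (\<Sum>z\<in>pverts G. arc_kernel G v z)" if "v \<in> pverts G" for v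
  proof -
    have "out_arcs G v = Pair v ` {z \<in> pverts G. (v, z) \<in> parcs G}"
      unfolding out_arcs_def using arc_snd_in_verts by force
    then have "out_degree G v = card {z \<in> pverts G. (v, z) \<in> parcs G}"
      unfolding out_degree_def by (simp add: card_image inj_on_def)
    then show ?thesis
      using pair_finite_verts by (simp add: sum.If_cases of_bool_def Int_def)
  qed
  have carrier: "signless_laplacian G \<in> carrier_mat n n"
    by (simp add: signless_laplacian_def degree_matrix_def adjacency_matrix_def Let_def n_def vs_def mat_diag_def)
  have entry: "signless_laplacian G $$ (i, j) = lap (pverts G) (arc_kernel G) (vs ! i) (vs ! j)"
    if "i < n" "j < n" for i j
  proof -
    have v: "vs ! i \<in> pverts G" "vs ! i = vs ! j \<longleftrightarrow> i = j"
      using that vs nth_mem[of i vs] nth_eq_iff_index_eq[of vs i j] by (simp_all add: n_def)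
    have e: "signless_laplacian G $$ (i, j) =
        (if i = j then real (out_degree G (vs ! i)) else 0) + arc_kernel G (vs ! i) (vs ! j)"
      using that by (simp add: signless_laplacian_def degree_matrix_def adjacency_matrix_def Let_def
          n_def mat_diag_def flip: vs_def)
    show ?thesis
      unfolding e lap_def v(2) deg[OF v(1)] using pair_no_loops[of "(vs ! i, vs ! i)"] by auto
  qed
  have "lap (pverts G) (arc_kernel G) x y = lap (pverts G) (arc_kernel G) y x" for x y
    using arcs_symmetric by (intro lap_sym) auto
  then have "SLEE G = estrada {..<n} (\<lambda>i j. signless_laplacian G $$ (i, j))"
    unfolding SLEE_def by (intro sum_exp_proots_symmetric carrier) (simp add: entry)
  also have "\<dots> = estrada {..<n} (\<lambda>i j. lap (pverts G) (arc_kernel G) (vs ! i) (vs ! j))"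
    by (intro estrada_cong) (simp add: entry)
  also have "\<dots> = estrada (pverts G) (lap (pverts G) (arc_kernel G))"
    by (rule estrada_reindex[OF bij])
  finally show ?thesis .
qed

section \<open>Paths with an attached clique\<close>

text \<open>Distance at most one, written with additions only to avoid truncated
  subtraction.\<close>

definition near :: "nat \<Rightarrow> nat \<Rightarrow> bool" where
  "near c x \<longleftrightarrow> x \<le> c + 1 \<and> c \<le> x + 1"

text \<open>The comparison graphs: 0, ..., \<open>d\<close> form the path, \<open>d + 1\<close>,
  ..., \<open>n - 1\<close> the clique, and \<open>i w\<close> is the centre of the clique vertex
  \<open>w\<close>. A constant \<open>i\<close> with value \<open>\<lceil>d / 2\<rceil>\<close>
  gives the extremal graph, see \<open>arcs_H1\<close>.\<close>

definition attached :: "nat \<Rightarrow> nat \<Rightarrow> (nat \<Rightarrow> nat) \<Rightarrow> nat \<Rightarrow> nat \<Rightarrow> bool" where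
  "attached n d i x y \<longleftrightarrow> x < n \<and> y < n \<and>
    ((x \<le> d \<and> y \<le> d \<and> (y = x + 1 \<or> x = y + 1)) \<or> (d < x \<and> d < y \<and> x \<noteq> y) \<or>
     (d < x \<and> y \<le> d \<and> near (i x) y) \<or> (d < y \<and> x \<le> d \<and> near (i y) x))"

abbreviation attached_kernel :: "nat \<Rightarrow> nat \<Rightarrow> (nat \<Rightarrow> nat) \<Rightarrow> nat \<Rightarrow> nat \<Rightarrow> real" where
  "attached_kernel n d i \<equiv> \<lambda>x y. of_bool (attached n d i x y)"

definition attached_estrada :: "nat \<Rightarrow> nat \<Rightarrow> (nat \<Rightarrow> nat) \<Rightarrow> real" where
  "attached_estrada n d i = estrada {..<n} (lap {..<n} (attached_kernel n d i))"

text \<open>The bounds ensure that each clique vertex has all three neighbours on the path.\<close>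

definition centres :: "nat \<Rightarrow> nat \<Rightarrow> (nat \<Rightarrow> nat) set" where
  "centres n d = {i. \<forall>w. d < w \<and> w < n \<longrightarrow> 1 \<le> i w \<and> i w < d}"

lemma attached_sym: "attached n d i x y \<longleftrightarrow> attached n d i y x"
  by (auto simp: attached_def)

lemma attached_irrefl: "\<not> attached n d i x x"
  by (auto simp: attached_def)

lemma attached_path: "x \<le> d \<Longrightarrow> y \<le> d \<Longrightarrow> d < n \<Longrightarrow> attached n d i x y \<longleftrightarrow> y = x + 1 \<or> x = y + 1"
  by (simp add: attached_def)

lemma attached_star: "x \<le> d \<Longrightarrow> d < w \<Longrightarrow> w < n \<Longrightarrow> attached n d i x w \<longleftrightarrow> near (i w) x"
  by (simp add: attached_def)

lemma attached_clique: "d < v \<Longrightarrow> d < w \<Longrightarrow> v < n \<Longrightarrow> w < n \<Longrightarrow> attached n d i v w \<longleftrightarrow> v \<noteq> w"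
  by (simp add: attached_def)

lemma attached_estrada_cong:
  assumes "\<And>w. d < w \<Longrightarrow> w < n \<Longrightarrow> i w = j w"
  shows "attached_estrada n d i = attached_estrada n d j"
proof -
  have "attached n d i = attached n d j"
    using assms by (auto simp: attached_def fun_eq_iff)
  then show ?thesis by (simp add: attached_estrada_def)
qed

section \<open>Reversal of the whole path\<close>

definition mirror :: "nat \<Rightarrow> nat \<Rightarrow> nat" where
  "mirror d x = (if x \<le> d then d - x else x)"

lemma bij_mirror: "d < n \<Longrightarrow> bij_betw (mirror d) {..<n} {..<n}"
  by (intro bij_betw_byWitness[of _ "mirror d"]) (auto simp: mirror_def)

lemma attached_mirror:
  assumes i: "i \<in> centres n d" and "d < n" and xy: "x < n" "y < n"
  shows "attached n d (\<lambda>w. d - i w) (mirror d x) (mirror d y) = attached n d i x y"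
proof -
  have near: "attached n d (\<lambda>w. d - i w) (mirror d u) (mirror d w) = attached n d i u w"
    if "u \<le> d" "d < w" "w < n" for u w
  proof -
    have "i w \<le> d" using i that by (auto simp: centres_def)
    then have "near (d - i w) (d - u) = near (i w) u"
      using \<open>u \<le> d\<close> unfolding near_def by linarith
    then show ?thesis using that by (simp add: attached_star mirror_def)
  qed
  consider "x \<le> d" "y \<le> d" | "x \<le> d" "d < y" | "d < x" "y \<le> d" | "d < x" "d < y" by linarith
  then show ?thesis
  proof cases
    case 1
    then have "(d - y = d - x + 1 \<or> d - x = d - y + 1) = (y = x + 1 \<or> x = y + 1)" by linarith
    then show ?thesis using 1 assms(2) by (simp add: attached_path mirror_def)
  next
    case 2
    then show ?thesis using near xy by blast
  next
    case 3
    then show ?thesis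
      using near[of y x] xy attached_sym[of n d _ _ "mirror d y"] attached_sym[of n d _ _ y] by blast
  next
    case 4
    then show ?thesis using xy by (simp add: attached_clique mirror_def)
  qed
qed

lemma attached_estrada_mirror:
  assumes "i \<in> centres n d" "d < n"
  shows "attached_estrada n d (\<lambda>w. d - i w) = attached_estrada n d i"
proof -
  let ?a = "attached_kernel n d (\<lambda>w. d - i w)"
  have "attached_estrada n d (\<lambda>w. d - i w) = estrada {..<n} (lap {..<n} (\<lambda>x y. ?a (mirror d x) (mirror d y)))"
    unfolding attached_estrada_def by (rule estrada_lap_reindex[OF bij_mirror[OF assms(2)], symmetric])
  also have "\<dots> = attached_estrada n d i"
    unfolding attached_estrada_def using attached_mirror[OF assms]
    by (intro estrada_cong lap_cong) auto
  finally show ?thesis .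
qed

section \<open>Polarization of the centres\<close>

definition reflect :: "nat \<Rightarrow> nat \<Rightarrow> nat" where
  "reflect s x = (if x \<le> s then s - x else x)"

definition polarize :: "nat \<Rightarrow> nat \<Rightarrow> nat" where
  "polarize s c = (if 2 * c < s then s - c else c)"

text \<open>Two-point rearrangement: the vertex on the larger side receives the union of the two
  adjacencies, its mirror image the intersection. The bound \<open>1 \<le> c\<close> keeps the
  neighbours of a moved centre within 0, ..., \<open>s\<close>; otherwise it could reach
  \<open>s + 1\<close>, which the reflection fixes.\<close>

lemma near_polarize:
  assumes "s \<le> 2 * x" "1 \<le> c"
  shows "near (polarize s c) x \<longleftrightarrow> near c x \<or> near c (reflect s x)"
    and "near (polarize s c) (reflect s x) \<longleftrightarrow> near c x \<and> near c (reflect s x)"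
  using assms unfolding near_def polarize_def reflect_def by (auto split: if_splits)

lemma reflection_reflect:
  assumes "s < n"
  shows "reflection {..<n} {x. x < n \<and> s \<le> 2 * x} (reflect s)"
  using assms by unfold_locales (auto simp: reflect_def split: if_splits)

text \<open>The cases stand for both endpoints moved, the second fixed, and the first fixed.
  Identifying truth values with 0 and 1, the sum is \<open>(1 + \<epsilon> * \<delta>) * A +
  (\<epsilon> + \<delta>) * B\<close>, \<open>(1 + \<delta>) * (A + \<epsilon> * B)\<close> or
  \<open>(1 + \<epsilon>) * (A + \<delta> * C)\<close>.\<close>

lemma sign_sum_nonneg:
  assumes "\<epsilon> \<in> {1,-1}" "\<delta> \<in> {1,-1}"
    and "(D = A \<and> B = C \<and> (B \<longrightarrow> A)) \<or> (C = A \<and> D = B \<and> (B \<longrightarrow> A)) \<or> (B = A \<and> D = C \<and> (C \<longrightarrow> A))"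
  shows "0 \<le> of_bool A + \<epsilon> * of_bool B + \<delta> * of_bool C + \<epsilon> * \<delta> * (of_bool D :: real)"
proof -
  have "\<epsilon> = 1 \<or> \<epsilon> = -1" "\<delta> = 1 \<or> \<delta> = -1" using assms by auto
  then show ?thesis
    using assms(3) by (elim disjE; cases A; cases B; cases C; cases D; simp)
qed

text \<open>Only the edges between path and clique change. Path edges need just nonnegative entries,
  and clique vertices are fixed by the reflection because \<open>s \<le> d\<close>.\<close>

lemma polarization_attached:
  assumes "s \<le> d" "d < n" "i \<in> centres n d"
  shows "polarization {..<n} {x. x < n \<and> s \<le> 2 * x} (reflect s)
    (attached_kernel n d i) (attached_kernel n d (\<lambda>w. polarize s (i w)))"
proof -
  let ?R = "{x. x < n \<and> s \<le> 2 * x}" and ?i = "\<lambda>w. polarize s (i w)"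
  let ?a = "attached_kernel n d i" and ?a' = "attached_kernel n d ?i"
  interpret reflection "{..<n}" ?R "reflect s"
    using assms by (intro reflection_reflect) auto
  \<comment> \<open>As \<open>w\<close> is fixed, the claim reduces to comparing the sum and the
    difference of two adjacencies with those of their union and intersection; the sum stays the
    same, and the difference becomes its absolute value.\<close>
  have star: "\<bar>par \<epsilon> \<delta> ?a x w\<bar> \<le> par \<epsilon> \<delta> ?a' x w"
    if "x \<in> ?R" "x \<le> d" "d < w" "w < n" "\<epsilon> \<in> {1,-1}" "\<delta> \<in> {1,-1}" for x w and \<epsilon> \<delta> :: real
  proof -
    have i: "1 \<le> i w" using assms that by (auto simp: centres_def)
    have w: "reflect s w = w" using assms that by (auto simp: reflect_def)
    have x: "reflect s x \<le> d" using assms that by (auto simp: reflect_def)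
    have "attached n d j x w = near (j w) x" "attached n d j (reflect s x) w = near (j w) (reflect s x)" for j
      using that x assms by (auto simp: attached_def)
    then show ?thesis
      unfolding par_def w using near_polarize[of s x "i w"] that(1,5,6) i
      by (cases "near (i w) x"; cases "near (i w) (reflect s x)") auto
  qed
  have par_swap: "par \<epsilon> \<delta> (attached_kernel n d j) x y = par \<delta> \<epsilon> (attached_kernel n d j) y x" for \<epsilon> \<delta> j x y
    by (simp add: par_def attached_sym[of n d j _ y] attached_sym[of n d j _ "reflect s y"])
  show ?thesis
  proof unfold_locales
    show "?a x y = ?a y x" "?a' x y = ?a' y x" "?a x x = 0" "?a' x x = 0" for x y
      by (simp_all add: attached_irrefl attached_sym[of _ _ _ x y])
    show "0 \<le> ?a x (reflect s x) \<and> ?a x (reflect s x) = ?a' x (reflect s x)" if "x \<in> ?R" for x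
    proof (cases "x \<le> s")
      case True
      then show ?thesis using assms(1,2) that by (auto simp: attached_def reflect_def)
    next
      case False
      then show ?thesis by (simp add: reflect_def attached_irrefl)
    qed
    fix x y and \<epsilon> \<delta> :: real
    assume xy: "x \<in> ?R" "y \<in> ?R" "x \<noteq> y" and s: "\<epsilon> \<in> {1,-1}" "\<delta> \<in> {1,-1}"
    consider "x \<le> d" "y \<le> d" | "x \<le> d" "d < y" | "d < x" "y \<le> d" | "d < x" "d < y" by linarith
    then show "\<bar>par \<epsilon> \<delta> ?a x y\<bar> \<le> par \<epsilon> \<delta> ?a' x y"
    proof cases
      case 1
      let ?p = "\<lambda>u v. v = u + 1 \<or> u = v + (1::nat)"
      have r: "reflect s x \<le> d" "reflect s y \<le> d" using 1 assms by (auto simp: reflect_def)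
      have a: "attached n d j u v = ?p u v" if "u \<le> d" "v \<le> d" for j u v
        using that assms(2) by (auto simp: attached_def)
      have "0 \<le> par \<epsilon> \<delta> (\<lambda>u v. of_bool (?p u v)) x y"
      proof -
        define A B C D where ABCD: "A = ?p x y" "B = ?p (reflect s x) y" "C = ?p x (reflect s y)"
          "D = ?p (reflect s x) (reflect s y)"
        have x: "s \<le> 2 * x" and y: "s \<le> 2 * y" and ne: "x \<noteq> y" using xy by auto
        have "(D = A \<and> B = C \<and> (B \<longrightarrow> A)) \<or> (C = A \<and> D = B \<and> (B \<longrightarrow> A)) \<or> (B = A \<and> D = C \<and> (C \<longrightarrow> A))"
        proof (cases "x \<le> s")
          case True
          \<comment> \<open>An edge from the mirror image of \<open>x\<close> to \<open>y\<close>
            means \<open>x + y = s + 1\<close>. Both lie in the upper half and differ, so they are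
            consecutive.\<close>
          then have B: "B \<longrightarrow> A" unfolding ABCD reflect_def using x y ne by (simp, linarith)
          show ?thesis
          proof (cases "y \<le> s")
            case y': True
            have "D = A" "B = C" unfolding ABCD reflect_def using x y ne True y' by (simp, linarith)+
            then show ?thesis using B by simp
          next
            case False
            then have "C = A" "D = B" unfolding ABCD by (simp_all add: reflect_def)
            then show ?thesis using B by simp
          qed
        next
          case False
          then have B: "C \<longrightarrow> A" unfolding ABCD reflect_def using x y ne by (simp, linarith)
          have "B = A" "D = C" unfolding ABCD using False by (simp_all add: reflect_def)
          then show ?thesis using B by simp
        qed
        then show ?thesis
          unfolding par_def ABCD[symmetric] by (rule sign_sum_nonneg[OF s])
      qed
      moreover have "par \<epsilon> \<delta> (attached_kernel n d j) x y = par \<epsilon> \<delta> (\<lambda>u v. of_bool (?p u v)) x y" for j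
        unfolding par_def a[OF 1] a[OF r(1) 1(2)] a[OF 1(1) r(2)] a[OF r] ..
      ultimately show ?thesis by (simp only: abs_of_nonneg order.refl)
    next
      case 2
      then show ?thesis using star xy s by auto
    next
      case 3
      then show ?thesis using star[of y x \<delta> \<epsilon>] xy s by (simp add: par_swap[of \<epsilon>])
    next
      case 4
      then have "reflect s x = x" "reflect s y = y" "?a x y = 1" "?a' x y = 1"
        using assms xy by (auto simp: reflect_def attached_def)
      then show ?thesis using s by (auto simp: par_def)
    qed
  qed
qed

lemma ktrace_polarize_le:
  assumes "s \<le> d" "d < n" "i \<in> centres n d"
  shows "ktrace {..<n} (lap {..<n} (attached_kernel n d i)) k \<le>
    ktrace {..<n} (lap {..<n} (attached_kernel n d (\<lambda>w. polarize s (i w)))) k"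
proof -
  interpret polarization "{..<n}" "{x. x < n \<and> s \<le> 2 * x}" "reflect s"
    "attached_kernel n d i" "attached_kernel n d (\<lambda>w. polarize s (i w))"
    by (rule polarization_attached[OF assms])
  show ?thesis by (rule ktrace_dom[OF dom_lap])
qed

lemma polarize_centres:
  assumes "s \<le> d" "i \<in> centres n d"
  shows "(\<lambda>w. polarize s (i w)) \<in> centres n d"
  using assms by (force simp: centres_def polarize_def)

text \<open>One strictly dominated entry of the \<open>k\<close>-th powers makes the Frobenius norm
  grow strictly, which is the trace of the power \<open>k + k\<close>.\<close>

lemma estrada_polarize_less:
  assumes "s \<le> d" "d < n" "i \<in> centres n d" "x < n" "s \<le> 2 * x" "y < n" "s \<le> 2 * y"
    and "\<epsilon> \<in> {1,-1}" "\<delta> \<in> {1,-1}"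
    and "\<bar>reflection.par (reflect s) \<epsilon> \<delta> (kpow {..<n} (lap {..<n} (attached_kernel n d i)) k) x y\<bar> <
      reflection.par (reflect s) \<epsilon> \<delta> (kpow {..<n} (lap {..<n} (attached_kernel n d (\<lambda>w. polarize s (i w)))) k) x y"
  shows "attached_estrada n d i < attached_estrada n d (\<lambda>w. polarize s (i w))"
proof -
  interpret polarization "{..<n}" "{x. x < n \<and> s \<le> 2 * x}" "reflect s"
    "attached_kernel n d i" "attached_kernel n d (\<lambda>w. polarize s (i w))"
    by (rule polarization_attached[OF assms(1-3)])
  have sym: "lap {..<n} (attached_kernel n d j) u v = lap {..<n} (attached_kernel n d j) v u" for j u v
    by (intro lap_sym) (simp add: attached_sym[of n d j])
  have "ktrace {..<n} (lap {..<n} (attached_kernel n d i)) (k + k) <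
      ktrace {..<n} (lap {..<n} (attached_kernel n d (\<lambda>w. polarize s (i w)))) (k + k)"
    unfolding ktrace_double[OF finite_lessThan sym]
    using assms by (intro sum_squares_strict[OF dom_kpow[OF dom_lap], of x y]) auto
  then show ?thesis
    unfolding attached_estrada_def
    using ktrace_polarize_le[OF assms(1-3)] by (intro estrada_strict_mono) auto
qed

text \<open>Two centres exchanged by the reflection: the vertices next to them see contributions of
  opposite signs before polarizing and of equal signs afterwards.\<close>

lemma estrada_merge_less:
  assumes "a + b \<le> d" "a < b" "d < n" "i \<in> centres n d"
    and u: "d < u" "u < n" "i u = a" and v: "d < v" "v < n" "i v = b"
  shows "attached_estrada n d i < attached_estrada n d (\<lambda>w. polarize (a + b) (i w))"
proof -
  \<comment> \<open>This reflection exchanges \<open>a\<close> and \<open>b\<close>. The vertex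
    \<open>b + 1\<close> is near \<open>b\<close> but not \<open>a\<close>, and its mirror image
    \<open>a - 1\<close> is near \<open>a\<close> but not \<open>b\<close>; after polarizing, both
    centres are at \<open>b\<close>.\<close>
  let ?s = "a + b" and ?x = "Suc b"
  interpret polarization "{..<n}" "{x. x < n \<and> ?s \<le> 2 * x}" "reflect ?s"
    "attached_kernel n d i" "attached_kernel n d (\<lambda>w. polarize ?s (i w))"
    by (rule polarization_attached[OF assms(1,3,4)])
  have ab: "1 \<le> a" "b < d" using assms by (auto simp: centres_def)
  have x: "?x \<in> {x. x < n \<and> ?s \<le> 2 * x}" "reflect ?s ?x = a - 1" "a - 1 \<noteq> ?x"
    using assms ab by (auto simp: reflect_def)
  have w: "reflect ?s w = w" if "d < w" for w using assms that by (auto simp: reflect_def)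
  have val: "attached n d j ?x w = near (j w) ?x" "attached n d j (a - 1) w = near (j w) (a - 1)"
    if "d < w" "w < n" for j w
    using that x assms ab by (auto simp: attached_def)
  have near: "\<not> near a ?x" "near b ?x" "near a (a - 1)" "\<not> near b (a - 1)"
    "near (polarize ?s a) ?x" "near (polarize ?s b) ?x"
    "\<not> near (polarize ?s a) (a - 1)" "\<not> near (polarize ?s b) (a - 1)"
    using assms(2) ab by (auto simp: near_def polarize_def)
  have "\<bar>outer (-1) (attached_kernel n d i) ?x\<bar> <
      outer (-1) (attached_kernel n d (\<lambda>w. polarize ?s (i w))) ?x"
  proof (rule outer_less[of _ _ u v])
    show "u \<in> {..<n} - {?x, reflect ?s ?x}" "v \<in> {..<n} - {?x, reflect ?s ?x}"
      using u v ab assms(1,2) unfolding x by auto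
    show "par (-1) 1 (attached_kernel n d i) ?x u < par (-1) 1 (attached_kernel n d (\<lambda>w. polarize ?s (i w))) ?x u"
      "- par (-1) 1 (attached_kernel n d i) ?x v < par (-1) 1 (attached_kernel n d (\<lambda>w. polarize ?s (i w))) ?x v"
      using u v near by (simp_all add: par_def x(2) w val del: One_nat_def)
  qed (use x in auto)
  \<comment> \<open>This entry of the Laplacian is the difference of the degrees of
    \<open>b + 1\<close> and \<open>a - 1\<close>, so the first power already shows the strict
    gain.\<close>
  moreover have "par 1 (-1) (lap {..<n} (attached_kernel n d j)) ?x ?x = outer (-1) (attached_kernel n d j) ?x" for j
    using x by (intro par_lap_diag) (auto simp: attached_irrefl attached_sym[of n d j])
  moreover have "par 1 (-1) (kpow {..<n} M (Suc 0)) ?x ?x = par 1 (-1) M ?x ?x" for M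
    unfolding par_def x(2) using x ab assms by (simp add: kpow_1 del: kpow.simps)
  ultimately show ?thesis
    using x assms by (intro estrada_polarize_less[of ?s d n i ?x ?x 1 "-1" "Suc 0"]) (auto simp del: kpow.simps)
qed

text \<open>Entries of powers count weighted walks that may pause. From the clique the path is
  entered at \<open>c + 1\<close> at the furthest, and each later step advances by at most
  one.\<close>

lemma kpow_attached_far:
  assumes "\<And>w. d < w \<Longrightarrow> w < n \<Longrightarrow> i w = c" "d < w" "w < n" "x \<le> d" "c + k < x"
  shows "kpow {..<n} (lap {..<n} (attached_kernel n d i)) k w x = 0"
  using assms(4,5)
proof (induction k arbitrary: x)
  case 0
  then show ?case using assms by simp
next
  case (Suc k)
  have "kpow {..<n} (lap {..<n} (attached_kernel n d i)) k w z * lap {..<n} (attached_kernel n d i) z x = 0"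
    if "z < n" for z
  proof (cases "z \<le> d \<and> x \<le> z + 1")
    case True
    then show ?thesis using Suc.prems Suc.IH[of z] by simp
  next
    case False
    then have "z \<noteq> x" "\<not> attached n d i z x"
      using Suc.prems assms(1)[of z] that by (auto simp: attached_def near_def)
    then show ?thesis by (simp add: lap_def)
  qed
  then show ?case unfolding kpow.simps by (intro sum.neutral) blast
qed

text \<open>The walk that enters the path at \<open>c + 1\<close> and then climbs it contributes a
  positive term, and no term is negative.\<close>

lemma kpow_attached_near:
  assumes "\<And>w. d < w \<Longrightarrow> w < n \<Longrightarrow> i w = c" "d < w" "w < n" "c + Suc k \<le> d"
  shows "0 < kpow {..<n} (lap {..<n} (attached_kernel n d i)) (Suc k) w (c + Suc k)"
  using assms(4)
proof (induction k)
  case 0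
  then have "attached n d i w (c + 1)" "w \<noteq> c + 1"
    using assms by (auto simp: attached_def near_def)
  then show ?case using assms by (simp add: kpow_1 lap_def del: kpow.simps)
next
  case (Suc k)
  let ?M = "lap {..<n} (attached_kernel n d i)"
  have M: "0 \<le> ?M u v" for u v by (simp add: lap_nonneg)
  have "attached n d i (c + Suc k) (c + Suc (Suc k))"
    using Suc.prems assms by (auto simp: attached_def)
  then have "?M (c + Suc k) (c + Suc (Suc k)) = 1" by (simp add: lap_def)
  then have "0 < (\<Sum>z<n. kpow {..<n} ?M (Suc k) w z * ?M z (c + Suc (Suc k)))"
    using Suc assms M
    by (intro sum_pos2[of _ "c + Suc k"] mult_nonneg_nonneg kpow_nonneg) (auto simp del: kpow.simps)
  then show ?case by (simp only: kpow.simps(2)[of _ _ "Suc k"])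
qed

text \<open>With a common centre there is nothing to merge. The gain comes from the end of the path
  beyond \<open>c + h\<close>, which the reflection leaves in place: from the clique, the fixed
  vertex \<open>c + h + 1\<close> is within \<open>c + 1\<close> steps for the centre
  \<open>h\<close> but not for \<open>c\<close>.\<close>

lemma estrada_shift_less:
  assumes "c < h" "c + h < d" "1 \<le> c" "d < n" "Suc d < n"
  shows "attached_estrada n d (\<lambda>_. c) < attached_estrada n d (\<lambda>_. h)"
proof -
  let ?s = "c + h" and ?w = "Suc d" and ?x = "Suc (c + h)"
  have c: "(\<lambda>_. c) \<in> centres n d" using assms by (auto simp: centres_def)
  have p: "polarize ?s c = h" using assms by (auto simp: polarize_def)
  interpret reflection "{..<n}" "{x. x < n \<and> ?s \<le> 2 * x}" "reflect ?s"
    using assms by (intro reflection_reflect) auto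
  have "reflect ?s ?w = ?w" "reflect ?s ?x = ?x" using assms by (auto simp: reflect_def)
  then have par: "par 1 1 F ?w ?x = 4 * F ?w ?x" for F by (simp add: par_def)
  have "kpow {..<n} (lap {..<n} (attached_kernel n d (\<lambda>_. c))) (Suc c) ?w ?x = 0"
    using assms by (intro kpow_attached_far[of d n _ c]) auto
  moreover have "0 < kpow {..<n} (lap {..<n} (attached_kernel n d (\<lambda>_. h))) (Suc c) ?w ?x"
    using kpow_attached_near[of d n "\<lambda>_. h" h ?w c] assms by (simp add: add.commute del: kpow.simps)
  ultimately have "\<bar>par 1 1 (kpow {..<n} (lap {..<n} (attached_kernel n d (\<lambda>_. c))) (Suc c)) ?w ?x\<bar> <
      par 1 1 (kpow {..<n} (lap {..<n} (attached_kernel n d (\<lambda>_. polarize ?s c))) (Suc c)) ?w ?x"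
    unfolding par p by (simp del: kpow.simps)
  then show ?thesis
    using estrada_polarize_less[of ?s d n "\<lambda>_. c" ?w ?x 1 1 "Suc c", OF _ _ c] assms by (simp add: p del: kpow.simps)
qed

text \<open>A maximizer exists by finiteness. Merging makes it constant, shifting makes the constant
  \<open>h\<close> or \<open>d - h\<close>, and these two are mirror images with equal value. Hence
  \<open>h\<close> attains the maximum and every maximizer has this form.\<close>

lemma attached_estrada_max:
  assumes d: "2 < d" "Suc d < n" and h: "d \<le> 2 * h" "2 * h \<le> d + 1" and i: "i \<in> centres n d"
  shows "attached_estrada n d i \<le> attached_estrada n d (\<lambda>_. h)"
    and "attached_estrada n d i = attached_estrada n d (\<lambda>_. h) \<Longrightarrow>
      \<exists>c\<in>{h, d - h}. \<forall>w. d < w \<and> w < n \<longrightarrow> i w = c"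
proof -
  let ?val = "attached_estrada n d"
  define maximal where "maximal m \<longleftrightarrow> m \<in> centres n d \<and> (\<forall>j\<in>centres n d. ?val j \<le> ?val m)" for m
  have hc: "(\<lambda>_. h) \<in> centres n d" using d h by (auto simp: centres_def)
  have mirror: "(\<lambda>w. d - j w) \<in> centres n d" "?val (\<lambda>w. d - j w) = ?val j" if "j \<in> centres n d" for j
    using that d attached_estrada_mirror[OF that] by (auto simp: centres_def)
  have maximal_mirror: "maximal (\<lambda>w. d - m w)" if "maximal m" for m
    using that mirror[of m] by (simp add: maximal_def)
  have no_merge: False if m: "maximal m" and w: "d < u" "u < n" "d < v" "v < n" "m u < m v" "m u + m v \<le> d" for m u v
    using estrada_merge_less[of "m u" "m v" d n m u v] polarize_centres[of "m u + m v" d m n] m w d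
    unfolding maximal_def by (smt (verit, best) Suc_lessD)
  \<comment> \<open>If the two centres add up to more than \<open>d\<close>, the reflection
    exchanging them does not fit into the path; then the mirrored assignment, also maximal, has a
    sum below \<open>d\<close>.\<close>
  have const: "m u = m v" if m: "maximal m" and w: "d < u" "u < n" "d < v" "v < n" for m u v
  proof (rule ccontr)
    assume "m u \<noteq> m v"
    have c: "m u < d" "m v < d" using m w by (auto simp: maximal_def centres_def)
    from \<open>m u \<noteq> m v\<close> c consider "m u < m v" "m u + m v \<le> d" | "m v < m u" "m u + m v \<le> d"
      | "d - m u < d - m v" "(d - m u) + (d - m v) \<le> d" | "d - m v < d - m u" "(d - m u) + (d - m v) \<le> d"
      by linarith
    then show False
      using no_merge[OF m, of u v] no_merge[OF m, of v u] no_merge[OF maximal_mirror[OF m], of u v]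
        no_merge[OF maximal_mirror[OF m], of v u] w
      by cases (simp_all add: add.commute)
  qed
  have no_shift: False if "maximal (\<lambda>_. c)" "c < h" "c + h < d" for c
  proof -
    have "1 \<le> c" using that(1) d(2) by (auto simp: maximal_def centres_def)
    then have "?val (\<lambda>_. c) < ?val (\<lambda>_. h)" using estrada_shift_less[OF that(2,3)] d(2) by simp
    moreover have "?val (\<lambda>_. h) \<le> ?val (\<lambda>_. c)" using that(1) hc unfolding maximal_def by blast
    ultimately show False by simp
  qed
  have const_cong: "maximal (\<lambda>_. m (Suc d))" if m: "maximal m" for m
  proof -
    have "m w = m (Suc d)" if "d < w" "w < n" for w
      using const[OF m that, of "Suc d"] d by simp
    then have "?val m = ?val (\<lambda>_. m (Suc d))" by (rule attached_estrada_cong)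
    moreover have "(\<lambda>_. m (Suc d)) \<in> centres n d" using m d by (auto simp: maximal_def centres_def)
    ultimately show ?thesis using m by (simp add: maximal_def)
  qed
  have unique: "m (Suc d) \<in> {h, d - h}" if m: "maximal m" for m
  proof (rule ccontr)
    let ?c = "m (Suc d)"
    assume "?c \<notin> {h, d - h}"
    moreover have "?c < d" using m d by (auto simp: maximal_def centres_def)
    \<comment> \<open>As \<open>h\<close> and \<open>d - h\<close> differ by at most one, any other
      centre is below \<open>d - h\<close> or above \<open>h\<close>, and reversal maps the second
      case to the first.\<close>
    ultimately consider "?c < h" "?c + h < d" | "d - ?c < h" "(d - ?c) + h < d"
      using h by force
    then show False
      using no_shift[OF const_cong[OF m]] no_shift[OF maximal_mirror[OF const_cong[OF m]]] by cases auto
  qed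
  have "\<exists>m. maximal m"
  proof -
    \<comment> \<open>Restricting assignments to the clique labels leaves finitely many without
      losing any value.\<close>
    let ?P = "PiE {d<..<n} (\<lambda>_. {1..<d})"
    have fin: "finite (?val ` ?P)" by (intro finite_imageI finite_PiE) auto
    have restr: "restrict j {d<..<n} \<in> ?P \<and> ?val (restrict j {d<..<n}) = ?val j" if "j \<in> centres n d" for j
      using that by (auto simp: centres_def intro!: attached_estrada_cong)
    then have "?val ` ?P \<noteq> {}" using hc by blast
    with fin have "Max (?val ` ?P) \<in> ?val ` ?P" by (rule Max_in)
    then obtain m where m: "m \<in> ?P" "?val m = Max (?val ` ?P)" by auto
    have "?val j \<le> ?val m" if "j \<in> centres n d" for j
      unfolding m(2) using restr[OF that] fin by (metis Max_ge imageI)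
    moreover have "m \<in> centres n d" using m(1) by (auto simp: centres_def PiE_iff)
    ultimately show ?thesis unfolding maximal_def by blast
  qed
  then obtain m where m: "maximal m" ..
  have max_val: "?val m = ?val (\<lambda>_. h)"
  proof -
    have "?val m = ?val (\<lambda>_. m (Suc d))"
      using const_cong[OF m] m unfolding maximal_def by (intro antisym) auto
    then show ?thesis using unique[OF m] mirror(2)[OF hc] by auto
  qed
  show "?val i \<le> ?val (\<lambda>_. h)"
    using m i unfolding maximal_def max_val by blast
  show "\<exists>c\<in>{h, d - h}. \<forall>w. d < w \<and> w < n \<longrightarrow> i w = c" if "?val i = ?val (\<lambda>_. h)"
  proof -
    have mi: "maximal i" using m i that max_val unfolding maximal_def by simp
    have "i w = i (Suc d)" if "d < w" "w < n" for w
      using const[OF mi that, of "Suc d"] d by simp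
    then show ?thesis using unique[OF mi] by blast
  qed
qed

section \<open>Graphs of given diameter\<close>

lemma digraph_isoI:
  assumes "pair_wf_digraph G" "inj_on c (pverts G)" "pverts H = c ` pverts G"
    "parcs H = map_prod c c ` parcs G"
  shows "digraph_iso (with_proj G) (with_proj H)"
proof -
  interpret pair_wf_digraph G by fact
  let ?hom = "\<lparr>iso_verts = c, iso_arcs = map_prod c c, iso_head = snd, iso_tail = fst\<rparr>"
  have "inj_on (map_prod c c) (parcs G)"
  proof (rule inj_on_subset)
    show "inj_on (map_prod c c) (pverts G \<times> pverts G)"
      using assms(2) by (rule map_prod_inj_on[OF assms(2)])
    show "parcs G \<subseteq> pverts G \<times> pverts G"
      using in_arcsD1 in_arcsD2 by auto
  qed
  then have "digraph_isomorphism ?hom"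
    unfolding digraph_isomorphism_def using assms wf_digraph_axioms by auto
  moreover have "with_proj H = app_iso ?hom (with_proj G)"
    using assms by (simp add: with_proj_def app_iso_def)
  ultimately show ?thesis unfolding digraph_iso_def by blast
qed

lemma (in pair_graph) graph_dist_nat:
  assumes "graph_dist G u v \<le> ereal c"
  obtains k where "graph_dist G u v = ereal (real k)"
proof -
  have "graph_dist G u v < \<infinity>" using assms by auto
  then have "u \<rightarrow>\<^sup>*\<^bsub>with_proj G\<^esub> v" using \<mu>_reach_conv[of "\<lambda>_. 1" u v] unfolding graph_dist_def by blast
  then obtain p where "\<mu> (\<lambda>_. 1) u v = awalk_cost (\<lambda>_. 1) p"
    using min_cost_awalk[of u v "\<lambda>_. 1"] by auto
  then have "graph_dist G u v = ereal (real (length p))"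
    by (simp add: graph_dist_def awalk_cost_def sum_list_triv)
  then show ?thesis by (rule that)
qed

lemma diameter_attained:
  assumes "finite (pverts G)" "pverts G \<noteq> {}"
  obtains u v where "u \<in> pverts G" "v \<in> pverts G" "graph_dist G u v = diameter G"
proof -
  have attained: "\<exists>x\<in>pverts G. F x = (SUP x\<in>pverts G. F x)" for F :: "'a \<Rightarrow> ereal"
  proof -
    have "Max (F ` pverts G) \<in> F ` pverts G" using assms by (intro Max_in) auto
    moreover have "Max (F ` pverts G) = (SUP x\<in>pverts G. F x)" using assms by (intro Max_Sup) auto
    ultimately show ?thesis by auto
  qed
  obtain u where u: "u \<in> pverts G" "(SUP v\<in>pverts G. graph_dist G u v) = diameter G"
    using attained[of "\<lambda>u. SUP v\<in>pverts G. graph_dist G u v"] unfolding diameter_def by auto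
  obtain v where "v \<in> pverts G" "graph_dist G u v = (SUP v\<in>pverts G. graph_dist G u v)"
    using attained[of "graph_dist G u"] by auto
  then show ?thesis using that u by simp
qed

lemma graph_dist_le_diameter:
  assumes "u \<in> pverts G" "v \<in> pverts G"
  shows "graph_dist G u v \<le> diameter G"
  unfolding diameter_def using assms by (intro SUP_upper2[of u] SUP_upper) auto

text \<open>Here \<open>f\<close> is the distance from one end of a diametral pair. The path is
  traced back from the other end through predecessors one step closer, so its \<open>k\<close>-th
  vertex has distance \<open>k\<close>.\<close>

lemma (in pair_graph) geodesic:
  assumes "pverts G \<noteq> {}" "diameter G = ereal (real d)"
  obtains f :: "'a \<Rightarrow> nat" and v :: "nat \<Rightarrow> 'a" where
    "\<And>x. x \<in> pverts G \<Longrightarrow> f x \<le> d"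
    "\<And>x y. (x, y) \<in> parcs G \<Longrightarrow> f y \<le> f x + 1"
    "\<And>k. k \<le> d \<Longrightarrow> v k \<in> pverts G \<and> f (v k) = k"
    "\<And>k. k < d \<Longrightarrow> (v k, v (Suc k)) \<in> parcs G"
proof -
  obtain r t where r: "r \<in> pverts G" and t: "t \<in> pverts G" "graph_dist G r t = ereal (real d)"
    using diameter_attained[of G] assms pair_finite_verts by metis
  have "\<exists>k. graph_dist G r x = ereal (real k)" if "x \<in> pverts G" for x
    using graph_dist_le_diameter[OF r that] assms(2) by (auto elim: graph_dist_nat)
  then obtain f where f: "\<And>x. x \<in> pverts G \<Longrightarrow> graph_dist G r x = ereal (real (f x))"
    by metis
  have f_le: "f x \<le> d" if "x \<in> pverts G" for x
    using graph_dist_le_diameter[OF r that] assms(2) f[OF that] by simp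
  have f_arc: "f y \<le> f x + 1" if "(x, y) \<in> parcs G" for x y
  proof -
    have "\<mu> (\<lambda>_. 1) r y \<le> \<mu> (\<lambda>_. 1) r x + ereal 1"
      using that by (intro pos_cost_mu_triangle[of _ "(x, y)"]) (auto simp: arc_to_ends_def)
    moreover have "x \<in> pverts G" "y \<in> pverts G" using that in_arcsD1 in_arcsD2 by auto
    ultimately show ?thesis using f unfolding graph_dist_def by simp
  qed
  have f_root: "f r = 0"
  proof -
    have "\<mu> (\<lambda>_. 1) r r \<le> awalk_cost (\<lambda>_. 1) []"
      using r by (intro min_cost_le_walk_cost) (simp add: awalk_Nil_iff)
    then show ?thesis using f[OF r] unfolding graph_dist_def by simp
  qed
  have pred: "\<exists>y. (y, x) \<in> parcs G \<and> f y = k" if "x \<in> pverts G" "f x = Suc k" for x k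
  proof -
    have "x \<noteq> r" using f_root that by auto
    moreover have "r \<rightarrow>\<^sup>*\<^bsub>with_proj G\<^esub> x"
      using f[OF that(1)] \<mu>_reach_conv[of "\<lambda>_. 1" r x] unfolding graph_dist_def by simp
    ultimately obtain y e where y: "\<mu> (\<lambda>_. 1) r x = \<mu> (\<lambda>_. 1) r y + ereal 1" "arc e (y, x)"
      using mu_exact_triangle_Ex[of x r "\<lambda>_. 1"] by auto
    then have "(y, x) \<in> parcs G" by (auto simp: arc_def)
    moreover from this have "f y = k"
      using y(1) f[OF that(1)] f[of y] that(2) in_arcsD1 unfolding graph_dist_def by simp
    ultimately show ?thesis by blast
  qed
  have "\<exists>v. (\<forall>i\<le>k. v i \<in> pverts G \<and> f (v i) = i) \<and> (\<forall>i<k. (v i, v (Suc i)) \<in> parcs G) \<and> v k = x"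
    if "x \<in> pverts G" "f x = k" for x k
    using that
  proof (induction k arbitrary: x)
    case 0
    then show ?case by (intro exI[of _ "\<lambda>_. x"]) auto
  next
    case (Suc k)
    from pred[OF Suc.prems] obtain y where y: "(y, x) \<in> parcs G" "f y = k" by blast
    from Suc.IH[of y] y in_arcsD1 obtain v where v: "\<forall>i\<le>k. v i \<in> pverts G \<and> f (v i) = i"
      "\<forall>i<k. (v i, v (Suc i)) \<in> parcs G" "v k = y" by blast
    show ?case
      using v y Suc.prems by (intro exI[of _ "v(Suc k := x)"]) (auto simp: le_Suc_eq less_Suc_eq)
  qed
  from this[of t d] t f[of t] obtain v where
    "\<forall>i\<le>d. v i \<in> pverts G \<and> f (v i) = i" "\<forall>i<d. (v i, v (Suc i)) \<in> parcs G" by auto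
  then show ?thesis using that[of f v] f_le f_arc by blast
qed

text \<open>A diametral geodesic receives the labels 0, ..., \<open>d\<close> and the remaining
  vertices the others in any order. Distances from its start differ by at most one along an edge,
  which makes the graph a spanning subgraph of a comparison graph.\<close>

lemma attached_labelling:
  fixes G :: "'a pair_pre_digraph"
  assumes "G \<in> graphs_with_diameter n d" "2 < d" "Suc d < n"
  obtains b i where "bij_betw b {..<n} (pverts G)" "i \<in> centres n d"
    "\<And>x y. x < n \<Longrightarrow> y < n \<Longrightarrow> (b x, b y) \<in> parcs G \<Longrightarrow> attached n d i x y"
proof -
  have G: "pair_graph G" "card (pverts G) = n" "diameter G = ereal (real d)"
    using assms(1) by (auto simp: graphs_with_diameter_def)
  interpret pair_graph G by fact
  have "pverts G \<noteq> {}" using G assms by auto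
  then obtain f and v :: "nat \<Rightarrow> 'a" where f: "\<And>x. x \<in> pverts G \<Longrightarrow> f x \<le> d"
    "\<And>x y. (x, y) \<in> parcs G \<Longrightarrow> f y \<le> f x + 1"
    and v: "\<And>k. k \<le> d \<Longrightarrow> v k \<in> pverts G \<and> f (v k) = k"
    using geodesic[OF _ G(3)] by metis
  have inj: "inj_on v {..d}" using v by (metis atMost_iff inj_onI)
  have sub: "v ` {..d} \<subseteq> pverts G" using v by auto
  have "card (pverts G - v ` {..d}) = n - Suc d"
    using card_Diff_subset[OF _ sub] G(2) card_image[OF inj] by simp
  then obtain g where g: "bij_betw g {d<..<n} (pverts G - v ` {..d})"
    using pair_finite_verts finite_same_card_bij[of "{d<..<n}" "pverts G - v ` {..d}"] by auto
  define b where "b x = (if x \<in> {..d} then v x else g x)" for x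
  have "bij_betw b ({..d} \<union> {d<..<n}) (v ` {..d} \<union> (pverts G - v ` {..d}))"
    unfolding b_def using inj g by (intro bij_betw_disjoint_Un) (auto simp: bij_betw_def)
  moreover have "{..d} \<union> {d<..<n} = {..<n}" using assms by auto
  moreover have "v ` {..d} \<union> (pverts G - v ` {..d}) = pverts G" using sub by auto
  ultimately have b: "bij_betw b {..<n} (pverts G)" by simp
  \<comment> \<open>The distance is clamped to 1, ..., \<open>d - 1\<close>. A vertex at distance
    \<open>d\<close> has path neighbours only at \<open>d - 1\<close> and \<open>d\<close>, which
    are still near the clamped centre.\<close>
  define i where "i w = max 1 (min (f (b w)) (d - 1))" for w
  have i: "i \<in> centres n d" using assms unfolding centres_def i_def by auto
  have "attached n d i x y" if xy: "x < n" "y < n" and e: "(b x, b y) \<in> parcs G" for x y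
  proof -
    have bV: "b x \<in> pverts G" "b y \<in> pverts G" using e in_arcsD1 in_arcsD2 by auto
    have ne: "x \<noteq> y" using e pair_no_loops by fastforce
    have fe: "f (b y) \<le> f (b x) + 1" "f (b x) \<le> f (b y) + 1"
      using f(2) e arcs_symmetric by blast+
    have path: "f (b x) = x" if "x \<le> d" for x using v that by (simp add: b_def)
    consider "x \<le> d" "y \<le> d" | "x \<le> d" "d < y" | "d < x" "y \<le> d" | "d < x" "d < y" by linarith
    then show ?thesis
    proof cases
      case 1
      then have "y = x + 1 \<or> x = y + 1" using fe path[of x] path[of y] ne by linarith
      then show ?thesis using 1 xy by (auto simp: attached_def)
    next
      case 2
      then have "near (i y) x"
        using fe path[of x] f(1)[OF bV(2)] assms unfolding near_def i_def by linarith
      then show ?thesis using 2 xy by (auto simp: attached_def)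
    next
      case 3
      then have "near (i x) y"
        using fe path[of y] f(1)[OF bV(1)] assms unfolding near_def i_def by linarith
      then show ?thesis using 3 xy by (auto simp: attached_def)
    next
      case 4
      then show ?thesis using xy ne by (auto simp: attached_def)
    qed
  qed
  then show ?thesis using that b i by blast
qed

section \<open>The diameter of the extremal graph\<close>

lemma (in pair_graph) graph_dist_ge:
  fixes f :: "'a \<Rightarrow> int"
  assumes "\<And>x y. (x, y) \<in> parcs G \<Longrightarrow> f y \<le> f x + 1"
  shows "ereal (real_of_int (f v - f u)) \<le> graph_dist G u v"
proof -
  have "f v - f u \<le> int (length p)" if "awalk u p v" for p
    using that
  proof (induction p arbitrary: u)
    case (Cons e p)
    then have "(u, snd e) \<in> parcs G" "awalk (snd e) p v" by (auto simp: awalk_Cons_iff)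
    then show ?case using assms[of u "snd e"] Cons.IH[of "snd e"] by simp
  qed (simp add: awalk_Nil_iff)
  then show ?thesis
    unfolding graph_dist_def \<mu>_def
    by (intro INF_greatest) (auto simp: awalk_cost_def sum_list_triv, metis of_int_le_iff of_int_of_nat_eq of_int_diff)
qed

text \<open>Maximality is assumed only among graphs of diameter \<open>d\<close>, so the competitor
  must be shown to be one. Explicit walks bound the diameter from above, a potential bounds it from
  below.\<close>

lemma diameter_attached_eq:
  fixes G :: "'a pair_pre_digraph"
  assumes "pair_graph G" "bij_betw b {..<n} (pverts G)" "Suc d < n" "1 \<le> h" "h < d"
    and arcs: "\<And>x y. x < n \<Longrightarrow> y < n \<Longrightarrow> (b x, b y) \<in> parcs G \<longleftrightarrow> attached n d (\<lambda>_. h) x y"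
  shows "diameter G = ereal (real d)"
proof -
  interpret pair_graph G by fact
  define W where "W k x y \<longleftrightarrow> (\<exists>p. awalk (b x) p (b y) \<and> length p = k)" for k x y
  have bV: "b x \<in> pverts G" if "x < n" for x using assms(2) that by (auto simp: bij_betw_def)
  have W_refl: "W 0 x x" if "x < n" for x
    unfolding W_def using bV[OF that] by (simp add: awalk_Nil_iff)
  have W_arc: "W 1 x y" if "attached n d (\<lambda>_. h) x y" for x y
  proof -
    have "(b x, b y) \<in> parcs G" using that arcs by (auto simp: attached_def)
    then have "awalk (b x) [(b x, b y)] (b y)"
      using in_arcsD1 in_arcsD2 by (auto simp: awalk_simps)
    then show ?thesis unfolding W_def by (metis One_nat_def length_Cons list.size(3))
  qed
  have W_trans: "W (j + k) x z" if "W j x y" "W k y z" for j k x y z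
    using that unfolding W_def by (metis awalk_appendI length_append)
  have W_sym: "W k y x" if "W k x y" for k x y
  proof -
    have "length (rev_path p) = length p" for p :: "('a \<times> 'a) list" by (induction p) auto
    then show ?thesis using that awalk_rev_path' unfolding W_def by metis
  qed
  have W_up: "W k x (x + k)" if "x + k \<le> d" for x k
    using that
  proof (induction k)
    case (Suc k)
    have "attached n d (\<lambda>_. h) (x + k) (x + Suc k)" using Suc.prems assms by (simp add: attached_def)
    then show ?case using W_trans[OF Suc.IH W_arc] Suc.prems by simp
  qed (use W_refl assms in auto)
  have W_path: "W (max x y - min x y) x y" if "x \<le> d" "y \<le> d" for x y
    using W_up[of x "y - x"] W_sym[OF W_up[of y "x - y"]] that by (cases "x \<le> y") (auto simp: max_def min_def)
  have W_star: "\<exists>k\<le>d. W k x w" if "x \<le> d" "d < w" "w < n" for x w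
  proof -
    \<comment> \<open>The path neighbour of the clique that is nearest to \<open>x\<close>.\<close>
    define a where "a = (if x < h then h - 1 else if x = h then h else h + 1)"
    have a: "a \<le> d" "near h a" "(max x a - min x a) + 1 \<le> d"
      using assms that unfolding a_def near_def by auto
    have "W ((max x a - min x a) + 1) x w"
      using a that by (intro W_trans[OF W_path W_arc]) (auto simp: attached_star)
    then show ?thesis using a(3) by blast
  qed
  have W_all: "\<exists>k\<le>d. W k x y" if xy: "x < n" "y < n" for x y
  proof -
    consider "x \<le> d" "y \<le> d" | "x \<le> d" "d < y" | "d < x" "y \<le> d" | "d < x" "d < y" "x \<noteq> y" | "x = y" by linarith
    then show ?thesis
    proof cases
      case 1
      then show ?thesis using W_path[of x y] by (intro exI[of _ "max x y - min x y"]) auto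
    next
      case 2
      then show ?thesis using W_star xy by blast
    next
      case 3
      then show ?thesis using W_star xy W_sym by blast
    next
      case 4
      then show ?thesis using W_arc[of x y] xy assms by (intro exI[of _ 1]) (auto simp: attached_clique)
    next
      case 5
      then show ?thesis using W_refl xy by blast
    qed
  qed
  have "graph_dist G u v \<le> ereal (real d)" if uv: "u \<in> pverts G" "v \<in> pverts G" for u v
  proof -
    obtain x y where "x < n" "y < n" "u = b x" "v = b y"
      using uv bij_betw_imp_surj_on[OF assms(2)] by (metis imageE lessThan_iff)
    with W_all obtain p where p: "awalk u p v" "length p \<le> d" unfolding W_def by blast
    have "graph_dist G u v \<le> awalk_cost (\<lambda>_. 1) p"
      unfolding graph_dist_def by (rule min_cost_le_walk_cost[OF p(1)])
    also have "\<dots> \<le> real d" using p(2) by (simp add: awalk_cost_def sum_list_triv)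
    finally show ?thesis .
  qed
  then have upper: "diameter G \<le> ereal (real d)"
    unfolding diameter_def by (intro SUP_least) auto
  define c where "c = the_inv_into {..<n} b"
  have c: "c (b x) = x" if "x < n" for x
    unfolding c_def using assms(2) that by (intro the_inv_into_f_f) (auto simp: bij_betw_def)
  \<comment> \<open>The position along the path, with the whole clique placed at the centre; it
    rises by at most one along any edge.\<close>
  define f where "f u = (if c u \<le> d then int (c u) else int h)" for u
  have "f v \<le> f u + 1" if e: "(u, v) \<in> parcs G" for u v
  proof -
    obtain x y where xy: "x < n" "y < n" "u = b x" "v = b y"
      using in_arcsD1[OF e] in_arcsD2[OF e] bij_betw_imp_surj_on[OF assms(2)]
      by (metis imageE lessThan_iff)
    then have "attached n d (\<lambda>_. h) x y" using e arcs by simp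
    then have "(if y \<le> d then y else h) \<le> (if x \<le> d then x else h) + 1"
      by (cases "x \<le> d"; cases "y \<le> d"; simp add: attached_def near_def; linarith)
    then show ?thesis unfolding f_def xy c[OF xy(1)] c[OF xy(2)] by (auto split: if_splits)
  qed
  then have "ereal (real_of_int (f (b d) - f (b 0))) \<le> graph_dist G (b 0) (b d)"
    by (rule graph_dist_ge)
  also have "f (b d) - f (b 0) = int d" using c assms by (simp add: f_def)
  also have "graph_dist G (b 0) (b d) \<le> diameter G"
    using bV assms by (intro graph_dist_le_diameter) auto
  finally show ?thesis using upper by simp
qed

section \<open>Identification of the maximizer\<close>

lemma SLEE_bij:
  assumes "pair_graph G" "bij_betw b {..<n} (pverts G)"
  shows "SLEE G = estrada {..<n} (lap {..<n} (\<lambda>x y. arc_kernel G (b x) (b y)))"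
  unfolding SLEE_eq_estrada[OF assms(1)] by (rule estrada_lap_reindex[OF assms(2), symmetric])

lemma arcs_H1:
  assumes "2 < d" "Suc d < n"
  shows "(x, y) \<in> parcs (H1 n d) \<longleftrightarrow> attached n d (\<lambda>_. nat \<lceil>real d / 2\<rceil>) x y"
proof -
  define h where "h = nat \<lceil>real d / 2\<rceil>"
  \<comment> \<open>Thus \<open>h - 1\<close> is not truncated and \<open>h + 1\<close> still lies
    on the path.\<close>
  have h: "2 \<le> h" "h < d" using assms unfolding h_def by linarith+
  have near: "z \<in> {h - 1, h, h + 1} \<longleftrightarrow> near h z" for z
    using h unfolding near_def by auto
  have "near h z \<Longrightarrow> z \<le> d" for z using h unfolding near_def by auto
  then show ?thesis
    unfolding H1_def H1_edge_def Let_def h_def[symmetric] near attached_def by auto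
qed

theorem theorem3p3:
  fixes n d :: nat and G :: "'a pair_pre_digraph"
  assumes "2 < d" and "d < n - 1"
    and "G \<in> graphs_with_diameter n d"
    and "\<And>G' :: 'a pair_pre_digraph. G' \<in> graphs_with_diameter n d \<Longrightarrow> SLEE G' \<le> SLEE G"
  shows "digraph_iso (with_proj G) (with_proj (H1 n d))"
proof -
  define h where "h = nat \<lceil>real d / 2\<rceil>"
  have h: "d \<le> 2 * h" "2 * h \<le> d + 1" "1 \<le> h" "h < d"
    using assms(1) unfolding h_def by linarith+
  have n: "Suc d < n" using assms(2) by simp
  have G: "pair_graph G" "card (pverts G) = n"
    using assms(3) by (auto simp: graphs_with_diameter_def)
  interpret pair_graph G by (rule G)
  obtain b i where b: "bij_betw b {..<n} (pverts G)" and i: "i \<in> centres n d"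
    and att: "\<And>x y. x < n \<Longrightarrow> y < n \<Longrightarrow> (b x, b y) \<in> parcs G \<Longrightarrow> attached n d i x y"
    using attached_labelling[OF assms(3,1) n] by blast
  have inj: "inj_on b {..<n}" and bV: "b ` {..<n} = pverts G"
    using b by (auto simp: bij_betw_def)
  \<comment> \<open>A copy of the extremal graph on the vertices of \<open>G\<close>, since the
    competitors in the hypothesis have the same vertex type.\<close>
  define H :: "'a pair_pre_digraph" where
    "H = \<lparr>pverts = pverts G, parcs = {(b x, b y) | x y. attached n d (\<lambda>_. h) x y}\<rparr>"
  have arcs_H: "(b x, b y) \<in> parcs H \<longleftrightarrow> attached n d (\<lambda>_. h) x y" if "x < n" "y < n" for x y
  proof
    assume "(b x, b y) \<in> parcs H"
    then obtain u v where uv: "b x = b u" "b y = b v" "attached n d (\<lambda>_. h) u v" unfolding H_def by auto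
    then have "u < n" "v < n" by (simp_all add: attached_def)
    then show "attached n d (\<lambda>_. h) x y" using uv that inj_onD[OF inj] by (metis lessThan_iff)
  qed (auto simp: H_def)
  have sub: "parcs H \<subseteq> pverts G \<times> pverts G"
    unfolding H_def bV[symmetric] by (auto simp: attached_def)
  have verts_H: "pverts H = pverts G" by (simp add: H_def)
  have H: "pair_graph H"
  proof
    show "finite (pverts H)" "finite (parcs H)"
      using pair_finite_verts finite_subset[OF sub] unfolding verts_H by auto
    show "symmetric H"
      unfolding symmetric_def sym_def using attached_sym[of n d "\<lambda>_. h"] by (auto simp: H_def)
    show "fst e \<in> pverts H" "snd e \<in> pverts H" if "e \<in> parcs H" for e
      using sub that unfolding verts_H by auto
    show "fst e \<noteq> snd e" if e: "e \<in> parcs H" for e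
    proof -
      obtain x y where xy: "e = (b x, b y)" "attached n d (\<lambda>_. h) x y" using e by (auto simp: H_def)
      then have "x < n" "y < n" "x \<noteq> y" by (auto simp: attached_def)
      then show ?thesis using xy inj_on_eq_iff[OF inj, of x y] by simp
    qed
  qed
  have bH: "bij_betw b {..<n} (pverts H)" using b unfolding verts_H .
  have "diameter H = ereal (real d)"
    using diameter_attached_eq[OF H bH n h(3,4) arcs_H] .
  then have "SLEE H \<le> SLEE G"
    using H G(2) by (intro assms(4)) (simp add: graphs_with_diameter_def H_def)
  moreover have "SLEE H = attached_estrada n d (\<lambda>_. h)"
    unfolding SLEE_bij[OF H bH] attached_estrada_def
    using arcs_H by (intro estrada_cong lap_cong) auto
  moreover have "SLEE G \<le> attached_estrada n d i"
    unfolding SLEE_bij[OF G(1) b] attached_estrada_def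
    using att by (intro estrada_lap_mono) auto
  \<comment> \<open>The chain from SLEE of \<open>H\<close> through SLEE of \<open>G\<close> and the
    comparison graph with centres \<open>i\<close> ends at the value of \<open>H\<close> again, so
    equality holds throughout.\<close>
  ultimately have eq: "attached_estrada n d i = attached_estrada n d (\<lambda>_. h)"
    "SLEE G = attached_estrada n d i"
    using attached_estrada_max(1)[OF assms(1) n h(1,2) i] by auto
  \<comment> \<open>A missing edge would make the second inequality of the chain strict.\<close>
  have arcs_G: "(b x, b y) \<in> parcs G \<longleftrightarrow> attached n d i x y" if "x < n" "y < n" for x y
  proof (rule ccontr)
    assume "\<not> ?thesis"
    then have "arc_kernel G (b x) (b y) < attached_kernel n d i x y" using att that by auto
    then have "SLEE G < attached_estrada n d i"
      unfolding SLEE_bij[OF G(1) b] attached_estrada_def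
      using that att by (intro estrada_lap_strict_mono[of _ _ _ x y]) auto
    then show False using eq by simp
  qed
  obtain c where c: "c \<in> {h, d - h}" "\<And>w. d < w \<Longrightarrow> w < n \<Longrightarrow> i w = c"
    using attached_estrada_max(2)[OF assms(1) n h(1,2) i eq(1)] by blast
  \<comment> \<open>If the common centre is \<open>d - h\<close>, composing the labelling with the
    reversal of the path moves it to \<open>h\<close>.\<close>
  obtain b' where b': "bij_betw b' {..<n} (pverts G)"
    and arcs': "\<And>x y. x < n \<Longrightarrow> y < n \<Longrightarrow> (b' x, b' y) \<in> parcs G \<longleftrightarrow> attached n d (\<lambda>_. h) x y"
  proof (cases "c = h")
    case True
    then have "attached n d i = attached n d (\<lambda>_. h)"
      using c(2) by (auto simp: attached_def fun_eq_iff)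
    then show ?thesis using that[of b] b arcs_G by simp
  next
    case False
    then have "attached n d i = attached n d (\<lambda>_. d - h)"
      using c by (auto simp: attached_def fun_eq_iff)
    moreover have "(\<lambda>_. h) \<in> centres n d" using h by (simp add: centres_def)
    moreover have "mirror d x < n" if "x < n" for x using that n by (auto simp: mirror_def)
    ultimately show ?thesis
      using that[of "b \<circ> mirror d"] bij_betw_trans[OF bij_mirror b] arcs_G n
        attached_mirror[of "\<lambda>_. h" n d] by simp
  qed
  have wf_H1: "pair_wf_digraph (H1 n d)"
    by (rule pair_wf_digraph.intro) (auto simp: H1_def)
  have "digraph_iso (with_proj (H1 n d)) (with_proj G)"
  proof (rule digraph_isoI)
    show "pair_wf_digraph (H1 n d)" by (rule wf_H1)
    show "inj_on b' (pverts (H1 n d))" "pverts G = b' ` pverts (H1 n d)"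
      using b' by (auto simp: bij_betw_def H1_def)
    show "parcs G = map_prod b' b' ` parcs (H1 n d)"
    proof (intro equalityI subsetI)
      fix e assume e: "e \<in> parcs G"
      then obtain x y where "x < n" "y < n" "e = (b' x, b' y)"
        using in_arcsD1[of "fst e" "snd e"] in_arcsD2[of "fst e" "snd e"] b'
        unfolding bij_betw_def by (metis imageE lessThan_iff prod.collapse)
      then show "e \<in> map_prod b' b' ` parcs (H1 n d)"
        using e arcs' arcs_H1[OF assms(1) n] by (intro image_eqI[of _ _ "(x, y)"]) (auto simp: h_def)
    next
      fix e assume "e \<in> map_prod b' b' ` parcs (H1 n d)"
      then obtain x y where xy: "(x, y) \<in> parcs (H1 n d)" "e = (b' x, b' y)" by auto
      moreover have "x < n" "y < n" using xy by (auto simp: H1_def)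
      ultimately show "e \<in> parcs G"
        using arcs' arcs_H1[OF assms(1) n] by (simp add: h_def)
    qed
  qed
  moreover have "wf_digraph (with_proj (H1 n d))"
    unfolding wf_digraph_wp_iff by (rule wf_H1)
  ultimately show ?thesis using digraph_iso_swap by blast
qed

end
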